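(* Suppose the orthogonalized snapshots $\overline u_j$ and $\overline w_j$ ($j=1,\ldots,n$) are obtained via the orthogonalization algorithm in the context (in particular, all the norms appearing there are nonzero). Let $\overline u_j^{\mathrm{GS}}$ denote the $j$th orthogonalized snapshot obtained via the Gram–Schmidt algorithm, i.e. $$\overline u_j^{\mathrm{GS}}=\widetilde u_{j-1}-\sum_{i=1}^{j-1}c_{ij}^u\,\overline u_i^{\mathrm{GS}},\qquad c_{ij}^u=\left\langle\widetilde u_{j-1},\frac{\overline u_i^{\mathrm{GS}}}{\|\overline u_i^{\mathrm{GS}}\|_{1/\widetilde v}}\right\rangle_{1/\widetilde v}\frac{1}{\|\overline u_i^{\mathrm{GS}}\|_{1/\widetilde v}}.$$ Then $\overline u_j^{\mathrm{GS}}=(d_j^u)^{-1}\,\overline u_j$, where $$d_j^u=\frac{1}{1-\sum_{i=1}^{j-1}\widehat\gamma_i\langle\widetilde u_{j-1},\overline u_i\rangle_{1/\widetilde v}}.$$ Similarly, let $$\overline w_j^{\mathrm{GS}}=\widetilde w_{j-1}-\sum_{i=1}^{j-1}c_{ij}^w\,\overline w_i^{\mathrm{GS}},\qquad c_{ij}^w=\left\langle\widetilde w_{j-1},\frac{\overline w_i^{\mathrm{GS}}}{\|\overline w_i^{\mathrm{GS}}\|_{\widetilde v}}\right\rangle_{\widetilde v}\frac{1}{\|\overline w_i^{\mathrm{GS}}\|_{\widetilde v}}.$$ Then $\overline w_j^{\mathrm{GS}}=(d_j^w)^{-1}\,\overline w_j$, where $$d_j^w=\frac{\sum_{i=1}^j\widehat\gamma_i}{(2j-1)\frac\tau2-\sum_{i=1}^{j-1}\left(\gamma_i\langle\widetilde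 w_{j-1},\overline w_i\rangle_{\widetilde v}\sum_{k=1}^i\widehat\gamma_k\right)}.$$ These hold for $j=1,\ldots,n$.
   Context: Let $\widetilde x_{\max}>0$, let $\widetilde v$ be a sufficiently regular positive function on $[0,\widetilde x_{\max}]$, and set $\langle f,g\rangle_{1/\widetilde v}=\int_0^{\widetilde x_{\max}}fg\frac1{\widetilde v}\,d\widetilde x$, $\langle f,g\rangle_{\widetilde v}=\int_0^{\widetilde x_{\max}}fg\,\widetilde v\,d\widetilde x$, with associated norms $\|\cdot\|_{1/\widetilde v}$, $\|\cdot\|_{\widetilde v}$. Let $\widetilde Af=-\widetilde v\,\partial_{\widetilde x}\!\left(\frac1{\widetilde v}\partial_{\widetilde x}f\right)$ with $f_{\widetilde x}(0)=0$, $f(\widetilde x_{\max})=0$ (self-adjoint, positive definite for $\langle\cdot,\cdot\rangle_{1/\widetilde v}$). Let $q\in L_1(\mathbb{R})$ be an even, sufficiently smooth approximation of $\delta(t)$ with nonnegative Fourier transform $\widetilde q(s^2)=\int_0^\infty2\cos(ts)q(t)\,dt$ and with $\widetilde q(\widetilde A)$ positive definite (e.g. $\widetilde q(s^2)=e^{-\sigma^2s^2/2}$, $\sigma>0$). Put $\widetilde b=\widetilde q(\widetilde A)^{1/2}\delta(\widetilde x+0)$, where $\delta(\widetilde x+0)$ is the right-half Dirac delta ($\int_0^\infty\delta(\widetilde x+0)\,d\widetilde x=1$). Let $(\widetilde u,\widetilde w)$ solve on $[0,\widetilde x_{\max}]\times[0,\infty[$: $\widetilde w_{\widetilde x}=\frac1{\widetilde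 v}\widetilde u_t$, $\widetilde u_{\widetilde x}=\widetilde v\,\widetilde w_t$, $\widetilde u|_{\widetilde x=\widetilde x_{\max}}=0$, $\widetilde w|_{\widetilde x=0}=0$, $\widetilde u|_{t=0}=\widetilde b$, $\widetilde w|_{t=0}=0$. Fix $\tau>0$, $n\in\mathbb{N}$. Primary and dual snapshots: $\widetilde u_k=\widetilde u(\cdot,k\tau)$, $\widetilde w_k=\widetilde w(\cdot,(k+\tfrac12)\tau)$, $k=0,\ldots,2n-1$. Let $L_\tau=\frac2\tau\,\partial_{\widetilde x}\,\widetilde A^{-1/2}\sin(\tfrac\tau2\sqrt{\widetilde A})$ and $L_\tau^T=-\frac2\tau\,\frac1{\widetilde v}\sin(\tfrac\tau2\sqrt{\widetilde A})\widetilde A^{-1/2}\,\widetilde v\,\partial_{\widetilde x}$ (the adjoint of $L_\tau$ in the standard inner product of $L^2[0,\widetilde x_{\max}]$). Orthogonalization algorithm: set $\overline w_0=0$, $\overline u_1=\widetilde b$; for $j=1,\ldots,n$ compute successively $\widehat\gamma_j=\|\overline u_j\|_{1/\widetilde v}^{-2}$; $\overline w_j=\overline w_{j-1}+\widehat\gamma_j\frac1{\widetilde v}L_\tau\overline u_j$; $\gamma_j=\|\overline w_j\|_{\widetilde v}^{-2}$; $\overline u_{j+1}=\overline u_j-\gamma_j\widetilde v\,L_\tau^T\overline w_j$. *)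

theory Defs
  imports "HOL-Analysis.Analysis"
begin

text \<open>Functions on \<open>[0, xm]\<close> are modelled by functions \<open>real \<Rightarrow> real\<close> whose values outside the
  interval are irrelevant: all integrals are over \<open>{0..xm}\<close>, all derivatives are taken within
  \<open>{0..xm}\<close> (one-sided at the end points).\<close>

definition ip :: "real \<Rightarrow> (real \<Rightarrow> real) \<Rightarrow> (real \<Rightarrow> real) \<Rightarrow> (real \<Rightarrow> real) \<Rightarrow> real" where
  "ip xm r f g = integral {0..xm} (\<lambda>x. f x * g x * r x)"

definition nrm :: "real \<Rightarrow> (real \<Rightarrow> real) \<Rightarrow> (real \<Rightarrow> real) \<Rightarrow> real" where
  "nrm xm r f = sqrt (ip xm r f f)"

definition L2 :: "real \<Rightarrow> (real \<Rightarrow> real) \<Rightarrow> (real \<Rightarrow> real) set" where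
  "L2 xm r = {f. f \<in> borel_measurable (lebesgue_on {0..xm}) \<and>
                 (\<lambda>x. (f x)\<^sup>2 * r x) integrable_on {0..xm}}"

definition recip :: "(real \<Rightarrow> real) \<Rightarrow> real \<Rightarrow> real" where
  "recip v = (\<lambda>x. 1 / v x)"

definition dx :: "real \<Rightarrow> (real \<Rightarrow> real) \<Rightarrow> real \<Rightarrow> real" where
  "dx xm f = (\<lambda>x. vector_derivative f (at x within {0..xm}))"

definition A_op :: "real \<Rightarrow> (real \<Rightarrow> real) \<Rightarrow> (real \<Rightarrow> real) \<Rightarrow> real \<Rightarrow> real" where
  "A_op xm v f = (\<lambda>x. - v x * dx xm (\<lambda>y. 1 / v y * dx xm f y) x)"

text \<open>The classical domain of the operator. It contains all eigenfunctions of the self-adjoint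
  realisation, which is all that the functional calculus below uses.\<close>

definition dom_A :: "real \<Rightarrow> (real \<Rightarrow> real) \<Rightarrow> (real \<Rightarrow> real) set" where
  "dom_A xm v = {f. f differentiable_on {0..xm} \<and>
                    (\<lambda>y. 1 / v y * dx xm f y) differentiable_on {0..xm} \<and>
                    continuous_on {0..xm} (A_op xm v f) \<and>
                    dx xm f 0 = 0 \<and> f xm = 0}"

definition eigenpair :: "real \<Rightarrow> (real \<Rightarrow> real) \<Rightarrow> real \<Rightarrow> (real \<Rightarrow> real) \<Rightarrow> bool" where
  "eigenpair xm v \<mu> f \<longleftrightarrow>
     f \<in> dom_A xm v \<and> (\<exists>x\<in>{0..xm}. f x \<noteq> 0) \<and> (\<forall>x\<in>{0..xm}. A_op xm v f x = \<mu> * f x)"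

definition expands :: "real \<Rightarrow> (real \<Rightarrow> real) \<Rightarrow> (nat \<Rightarrow> real \<Rightarrow> real) \<Rightarrow> (nat \<Rightarrow> real) \<Rightarrow> (real \<Rightarrow> real) \<Rightarrow> bool"
  where
  "expands xm r \<phi> c h \<longleftrightarrow>
     h \<in> L2 xm r \<and> (\<lambda>N. nrm xm r (\<lambda>x. h x - (\<Sum>k<N. c k * \<phi> k x))) \<longlonglongrightarrow> 0"

definition eigenbasis :: "real \<Rightarrow> (real \<Rightarrow> real) \<Rightarrow> (nat \<Rightarrow> real) \<Rightarrow> (nat \<Rightarrow> real \<Rightarrow> real) \<Rightarrow> bool" where
  "eigenbasis xm v \<mu> \<phi> \<longleftrightarrow>
     (\<forall>k. eigenpair xm v (\<mu> k) (\<phi> k)) \<and>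
     (\<forall>j k. ip xm (recip v) (\<phi> j) (\<phi> k) = (if j = k then 1 else 0)) \<and>
     (\<forall>f \<in> L2 xm (recip v). expands xm (recip v) \<phi> (\<lambda>k. ip xm (recip v) f (\<phi> k)) f)"

text \<open>Functional calculus of the operator: \<open>op_image xm v g p h\<close> says that \<open>h = g(A) f\<close> in
  \<open>L\<^sup>2\<close>, where the (possibly generalized) function \<open>f\<close> is given by its pairing
  \<open>p \<phi> = \<langle>f, \<phi>\<rangle>\<close> with eigenfunctions. By Sturm-Liouville theory an
  orthonormal eigenbasis exists, and \<open>h\<close> does not depend on which one is used.\<close>

definition op_image ::
  "real \<Rightarrow> (real \<Rightarrow> real) \<Rightarrow> (real \<Rightarrow> real) \<Rightarrow> ((real \<Rightarrow> real) \<Rightarrow> real) \<Rightarrow> (real \<Rightarrow> real) \<Rightarrow> bool" where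
  "op_image xm v g p h \<longleftrightarrow>
     (\<exists>\<mu> \<phi>. eigenbasis xm v \<mu> \<phi> \<and> expands xm (recip v) \<phi> (\<lambda>k. g (\<mu> k) * p (\<phi> k)) h)"

text \<open>\<open>g(A) f\<close> as a function, for those \<open>g\<close> and \<open>f\<close> where it has a continuous representative
  (for \<open>g = sinc_fn \<tau>\<close> below these are all \<open>f\<close> in \<open>L\<^sup>2\<close>, since then \<open>g(A) f\<close> is in \<open>H\<^sup>1\<close>).\<close>

definition op_apply :: "real \<Rightarrow> (real \<Rightarrow> real) \<Rightarrow> (real \<Rightarrow> real) \<Rightarrow> (real \<Rightarrow> real) \<Rightarrow> real \<Rightarrow> real" where
  "op_apply xm v g f =
     (THE h. op_image xm v g (ip xm (recip v) f) h \<and>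
             continuous_on {0..xm} h \<and> (\<forall>x. x \<notin> {0..xm} \<longrightarrow> h x = 0))"

definition op_pos_def :: "real \<Rightarrow> (real \<Rightarrow> real) \<Rightarrow> (real \<Rightarrow> real) \<Rightarrow> bool" where
  "op_pos_def xm v g \<longleftrightarrow>
     (\<forall>f h. f \<in> L2 xm (recip v) \<longrightarrow> nrm xm (recip v) f \<noteq> 0 \<longrightarrow>
            op_image xm v g (ip xm (recip v) f) h \<longrightarrow> 0 < ip xm (recip v) h f)"

text \<open>Pairing of the right-half Dirac delta with \<open>\<phi>\<close> in the inner product with weight \<open>1/v\<close>.\<close>

definition delta_pairing :: "(real \<Rightarrow> real) \<Rightarrow> (real \<Rightarrow> real) \<Rightarrow> real" where
  "delta_pairing v \<phi> = \<phi> 0 * (1 / v 0)"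

text \<open>The function written \<open>s\<^sup>2 \<mapsto> \<integral>\<^sub>0\<^sup>\<infinity> 2 cos(t s) q(t) dt\<close> in terms of the
  variable \<open>\<mu> = s\<^sup>2 \<ge> 0\<close>.\<close>

definition q_tilde :: "(real \<Rightarrow> real) \<Rightarrow> real \<Rightarrow> real" where
  "q_tilde q \<mu> = (LBINT t:{0..}. 2 * cos (t * sqrt \<mu>) * q t)"

definition admissible_q :: "real \<Rightarrow> (real \<Rightarrow> real) \<Rightarrow> (real \<Rightarrow> real) \<Rightarrow> bool" where
  "admissible_q xm v q \<longleftrightarrow>
     integrable lborel q \<and> (\<forall>t. q (- t) = q t) \<and> (\<forall>s. 0 \<le> q_tilde q (s\<^sup>2)) \<and>
     op_pos_def xm v (q_tilde q)"

text \<open>Classical (continuously differentiable) solutions \<open>u x t\<close>, \<open>w x t\<close>.\<close>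

definition wave_solution ::
  "real \<Rightarrow> (real \<Rightarrow> real) \<Rightarrow> (real \<Rightarrow> real) \<Rightarrow> (real \<Rightarrow> real \<Rightarrow> real) \<Rightarrow> (real \<Rightarrow> real \<Rightarrow> real) \<Rightarrow> bool" where
  "wave_solution xm v b u w \<longleftrightarrow>
     (\<exists>ux ut wx wt.
        (\<forall>F\<in>{ux, ut, wx, wt}. continuous_on ({0..xm} \<times> {0..}) (\<lambda>(x, t). F x t)) \<and>
        (\<forall>x\<in>{0..xm}. \<forall>t\<ge>0.
           ((\<lambda>y. u y t) has_real_derivative ux x t) (at x within {0..xm}) \<and>
           ((\<lambda>s. u x s) has_real_derivative ut x t) (at t within {0..}) \<and>
           ((\<lambda>y. w y t) has_real_derivative wx x t) (at x within {0..xm}) \<and>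
           ((\<lambda>s. w x s) has_real_derivative wt x t) (at t within {0..}) \<and>
           wx x t = 1 / v x * ut x t \<and>
           ux x t = v x * wt x t)) \<and>
     (\<forall>t\<ge>0. u xm t = 0 \<and> w 0 t = 0) \<and>
     (\<forall>x\<in>{0..xm}. u x 0 = b x \<and> w x 0 = 0)"

definition u_snap :: "(real \<Rightarrow> real \<Rightarrow> real) \<Rightarrow> real \<Rightarrow> nat \<Rightarrow> real \<Rightarrow> real" where
  "u_snap u \<tau> k = (\<lambda>x. u x (real k * \<tau>))"

definition w_snap :: "(real \<Rightarrow> real \<Rightarrow> real) \<Rightarrow> real \<Rightarrow> nat \<Rightarrow> real \<Rightarrow> real" where
  "w_snap w \<tau> k = (\<lambda>x. w x ((real k + 1 / 2) * \<tau>))"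

definition sinc_fn :: "real \<Rightarrow> real \<Rightarrow> real" where
  "sinc_fn \<tau> \<mu> = sin (\<tau> / 2 * sqrt \<mu>) / sqrt \<mu>"

definition L_tau :: "real \<Rightarrow> (real \<Rightarrow> real) \<Rightarrow> real \<Rightarrow> (real \<Rightarrow> real) \<Rightarrow> real \<Rightarrow> real" where
  "L_tau xm v \<tau> f = (\<lambda>x. 2 / \<tau> * dx xm (op_apply xm v (sinc_fn \<tau>) f) x)"

definition L_tau_T :: "real \<Rightarrow> (real \<Rightarrow> real) \<Rightarrow> real \<Rightarrow> (real \<Rightarrow> real) \<Rightarrow> real \<Rightarrow> real" where
  "L_tau_T xm v \<tau> f =
     (\<lambda>x. - (2 / \<tau>) * (1 / v x) * op_apply xm v (sinc_fn \<tau>) (\<lambda>y. v y * dx xm f y) x)"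

definition orthogonalization ::
  "real \<Rightarrow> (real \<Rightarrow> real) \<Rightarrow> real \<Rightarrow> nat \<Rightarrow> (real \<Rightarrow> real) \<Rightarrow> (nat \<Rightarrow> real \<Rightarrow> real) \<Rightarrow> (nat \<Rightarrow> real \<Rightarrow> real) \<Rightarrow>
   (nat \<Rightarrow> real) \<Rightarrow> (nat \<Rightarrow> real) \<Rightarrow> bool" where
  "orthogonalization xm v \<tau> n b ub wb \<gamma>h \<gamma> \<longleftrightarrow>
     (\<forall>x\<in>{0..xm}. wb 0 x = 0 \<and> ub 1 x = b x) \<and>
     (\<forall>j\<in>{1..n}.
        nrm xm (recip v) (ub j) \<noteq> 0 \<and>
        \<gamma>h j = 1 / (nrm xm (recip v) (ub j))\<^sup>2 \<and>
        (\<forall>x\<in>{0..xm}. wb j x = wb (j - 1) x + \<gamma>h j * (1 / v x) * L_tau xm v \<tau> (ub j) x) \<and>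
        nrm xm v (wb j) \<noteq> 0 \<and>
        \<gamma> j = 1 / (nrm xm v (wb j))\<^sup>2 \<and>
        (\<forall>x\<in>{0..xm}. ub (j + 1) x = ub j x - \<gamma> j * v x * L_tau_T xm v \<tau> (wb j) x))"

definition gram_schmidt ::
  "real \<Rightarrow> (real \<Rightarrow> real) \<Rightarrow> nat \<Rightarrow> (nat \<Rightarrow> real \<Rightarrow> real) \<Rightarrow> (nat \<Rightarrow> real \<Rightarrow> real) \<Rightarrow> bool" where
  "gram_schmidt xm r n s g \<longleftrightarrow>
     (\<forall>j\<in>{1..n}. \<forall>x\<in>{0..xm}.
        g j x = s (j - 1) x
          - (\<Sum>i = 1..<j. ip xm r (s (j - 1)) (\<lambda>y. g i y / nrm xm r (g i)) * (1 / nrm xm r (g i)) * g i x))"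

text \<open>Since \<open>y / 0 = 0\<close> in HOL, \<open>d_u \<dots> \<noteq> 0\<close> and \<open>d_w \<dots> \<noteq> 0\<close> in particular say that the denominators
  below do not vanish.\<close>

definition d_u :: "real \<Rightarrow> (real \<Rightarrow> real) \<Rightarrow> (nat \<Rightarrow> real \<Rightarrow> real) \<Rightarrow> (nat \<Rightarrow> real \<Rightarrow> real) \<Rightarrow>
   (nat \<Rightarrow> real) \<Rightarrow> nat \<Rightarrow> real" where
  "d_u xm v us ub \<gamma>h j = 1 / (1 - (\<Sum>i = 1..<j. \<gamma>h i * ip xm (recip v) (us (j - 1)) (ub i)))"

definition d_w :: "real \<Rightarrow> (real \<Rightarrow> real) \<Rightarrow> real \<Rightarrow> (nat \<Rightarrow> real \<Rightarrow> real) \<Rightarrow> (nat \<Rightarrow> real \<Rightarrow> real) \<Rightarrow>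
   (nat \<Rightarrow> real) \<Rightarrow> (nat \<Rightarrow> real) \<Rightarrow> nat \<Rightarrow> real" where
  "d_w xm v \<tau> ws wb \<gamma>h \<gamma> j =
     (\<Sum>i = 1..j. \<gamma>h i) /
     ((2 * real j - 1) * (\<tau> / 2)
        - (\<Sum>i = 1..<j. \<gamma> i * ip xm v (ws (j - 1)) (wb i) * (\<Sum>k = 1..i. \<gamma>h k)))"

end

theory Submission
  imports Defs
begin

text \<open>
  Tested against an eigenfunction \<open>\<psi>\<close> of \<open>A\<close> with eigenvalue \<open>\<mu> = s\<^sup>2\<close>, the wave system is a harmonic
  oscillator, so the pairings of \<open>u\<close> with \<open>\<psi>\<close> and of \<open>w\<close> with \<open>\<psi>'\<close> are \<open>a cos(st)\<close> and \<open>a s sin(st)\<close>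
  (\<open>wave_solution_pairings\<close>). Write \<open>P = (1/v) L\<^sub>\<tau>\<close> and \<open>Q = v L\<^sub>\<tau>\<^sup>T\<close>. The addition theorems turn the
  oscillation into the leapfrog relations \<open>w\<^sub>k - w\<^sub>k\<^sub>-\<^sub>1 = \<tau> P u\<^sub>k\<close> and \<open>u\<^sub>k - u\<^sub>k\<^sub>+\<^sub>1 = \<tau> Q w\<^sub>k\<close>, where
  the dual snapshot with index \<open>-1\<close> is the negative of the one with index \<open>0\<close>
  (\<open>half_step_u_snap\<close>, \<open>half_step_w_snap\<close>).

  \<open>P\<close> and \<open>Q\<close> are adjoint between the two weighted inner products, because \<open>sinc(A)\<close> is self-adjoint
  (\<open>half_step_adjoint\<close>). The algorithm is a two-term recursion driven by this adjoint pair, with step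
  lengths equal to the inverse squared norms, and an induction shows that both families of
  iterates are orthogonal (\<open>coupled_recursion_orthogonal\<close>), as for Lanczos bidiagonalization.

  Conversely, substituting \<open>P\<close> and \<open>Q\<close> of the iterates into the leapfrog relations expresses the \<open>j\<close>-th
  snapshot through the first \<open>j\<close> iterates with nonzero last coefficient (\<open>snapshot_expansion\<close>). Hence
  Gram-Schmidt returns the iterates up to these last coefficients (\<open>gram_schmidt_triangular\<close>). Their
  values come from one linear identity for each family: the coefficients of a primary snapshot add up to
  \<open>1\<close>, and those of the \<open>j\<close>-th dual snapshot, weighted with the partial sums of \<open>\<gamma>h\<close>, to \<open>(2j-1)\<tau>/2\<close>. All
  other coefficients are inner products by orthogonality, so solving for the last one gives
  \<open>1/d\<^sub>u\<close> and \<open>1/d\<^sub>w\<close>.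

  The operators are only given through expansions in some eigenbasis. They are handled by
  pairings: a continuous function having the right pairing with every
  eigenfunction is the value of the functional calculus (\<open>op_apply_eqI\<close>).
\<close>

section \<open>Weighted inner products of continuous functions\<close>

lemma ip_integrable:
  fixes r f g :: "real \<Rightarrow> real"
  assumes "continuous_on {0..xm} r" "continuous_on {0..xm} f" "continuous_on {0..xm} g"
  shows "(\<lambda>x. f x * g x * r x) integrable_on {0..xm}"
  by (intro integrable_continuous_real continuous_on_mult assms)

lemma ip_cong:
  assumes "\<And>x. x \<in> {0..xm} \<Longrightarrow> f x = f' x" "\<And>x. x \<in> {0..xm} \<Longrightarrow> g x = g' x"
    "\<And>x. x \<in> {0..xm} \<Longrightarrow> r x = r' x"
  shows "ip xm r f g = ip xm r' f' g'"
  unfolding ip_def by (rule integral_cong) (simp add: assms)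

lemma ip_commute: "ip xm r f g = ip xm r g f"
  by (simp add: ip_def mult.commute)

lemma ip_lincomb_left:
  assumes "continuous_on {0..xm} r" "continuous_on {0..xm} f" "continuous_on {0..xm} g"
    "continuous_on {0..xm} h"
  shows "ip xm r (\<lambda>x. a * f x + c * g x) h = a * ip xm r f h + c * ip xm r g h"
proof -
  have "integral {0..xm} (\<lambda>x. a * (f x * h x * r x) + c * (g x * h x * r x))
      = a * ip xm r f h + c * ip xm r g h"
    unfolding ip_def by (subst integral_add) (auto intro!: integrable_on_mult_right ip_integrable assms)
  then show ?thesis
    by (simp add: ip_def algebra_simps)
qed

lemma ip_scale_left: "ip xm r (\<lambda>x. c * f x) g = c * ip xm r f g"
proof -
  have "ip xm r (\<lambda>x. c * f x) g = integral {0..xm} (\<lambda>x. c * (f x * g x * r x))"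
    by (simp add: ip_def algebra_simps)
  then show ?thesis by (simp add: ip_def)
qed

lemma ip_diff_left:
  assumes "continuous_on {0..xm} r" "continuous_on {0..xm} f" "continuous_on {0..xm} g"
    "continuous_on {0..xm} h"
  shows "ip xm r (\<lambda>x. f x - g x) h = ip xm r f h - ip xm r g h"
  using ip_lincomb_left[OF assms, of 1 "-1"] by simp

lemma ip_sum_left:
  assumes "finite A" "continuous_on {0..xm} r" "\<And>i. i \<in> A \<Longrightarrow> continuous_on {0..xm} (f i)"
    "continuous_on {0..xm} h"
  shows "ip xm r (\<lambda>x. \<Sum>i\<in>A. c i * f i x) h = (\<Sum>i\<in>A. c i * ip xm r (f i) h)"
  using assms(1,3)
proof (induction A)
  case empty
  then show ?case by (simp add: ip_def)
next
  case (insert i A)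
  have "continuous_on {0..xm} (\<lambda>x. \<Sum>i\<in>A. c i * f i x)"
    using insert.prems by (intro continuous_intros) auto
  with insert assms(2,4) show ?case
    using ip_lincomb_left[of xm r "f i" "\<lambda>x. \<Sum>i\<in>A. c i * f i x" h "c i" 1] by simp
qed

text \<open>The integrand is continuous and nonnegative, so a nonpositive integral forces it to vanish at every
  point, end points included.\<close>

lemma ip_self_zeroD:
  assumes "xm > 0" "continuous_on {0..xm} r" "\<forall>x\<in>{0..xm}. r x > 0" "continuous_on {0..xm} f"
    "ip xm r f f \<le> 0" "x \<in> {0..xm}"
  shows "f x = 0"
proof -
  have nn: "0 \<le> f x * f x * r x" if "x \<in> {0..xm}" for x
    using assms(3) that by (simp add: less_imp_le)
  have "0 \<le> ip xm r f f"
    unfolding ip_def by (rule integral_nonneg[OF ip_integrable]) (use assms nn in auto)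
  with assms have "integral {0..xm} (\<lambda>x. f x * f x * r x) = 0"
    by (simp add: ip_def)
  then have "\<forall>x\<in>{0..xm}. f x * f x * r x = 0"
    by (subst (asm) integral_eq_0_iff) (use assms nn in \<open>auto intro!: continuous_intros\<close>)
  with assms show ?thesis by (metis less_irrefl mult_eq_0_iff)
qed

lemma ip_self_nonneg:
  assumes "continuous_on {0..xm} r" "\<forall>x\<in>{0..xm}. r x > 0" "continuous_on {0..xm} f"
  shows "0 \<le> ip xm r f f"
  unfolding ip_def
  by (rule integral_nonneg[OF ip_integrable]) (use assms in \<open>auto simp: less_imp_le\<close>)

lemma nrm_power2:
  assumes "continuous_on {0..xm} r" "\<forall>x\<in>{0..xm}. r x > 0" "continuous_on {0..xm} f"
  shows "(nrm xm r f)\<^sup>2 = ip xm r f f"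
  using ip_self_nonneg[OF assms] by (simp add: nrm_def)

lemma ip_Cauchy_Schwarz:
  assumes "xm > 0" "continuous_on {0..xm} r" "\<forall>x\<in>{0..xm}. r x > 0"
    "continuous_on {0..xm} f" "continuous_on {0..xm} g"
  shows "\<bar>ip xm r f g\<bar> \<le> nrm xm r f * nrm xm r g"
proof (cases "ip xm r g g = 0")
  case True
  then have "g x = 0" if "x \<in> {0..xm}" for x
    using ip_self_zeroD[OF assms(1,2,3,5) _ that] by simp
  then have "ip xm r f g = ip xm r f (\<lambda>_. 0)" by (intro ip_cong) auto
  then show ?thesis
    using True by (simp add: ip_def nrm_def)
next
  case False
  define d where "d = (\<lambda>x. ip xm r g g * f x + (- ip xm r f g) * g x)"
  have cd: "continuous_on {0..xm} d"
    unfolding d_def by (intro continuous_intros assms)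
  have pair: "ip xm r d h = ip xm r g g * ip xm r f h - ip xm r f g * ip xm r g h"
    if "continuous_on {0..xm} h" for h
    unfolding d_def using ip_lincomb_left[OF assms(2,4,5) that, of "ip xm r g g" "- ip xm r f g"] by simp
  have "ip xm r d d = ip xm r g g * (ip xm r g g * ip xm r f f - (ip xm r f g)\<^sup>2)"
    unfolding pair[OF cd] ip_commute[of xm r f d] ip_commute[of xm r g d] pair[OF assms(4)] pair[OF assms(5)]
    by (simp add: ip_commute[of xm r g f] power2_eq_square algebra_simps)
  moreover have "0 \<le> ip xm r d d" "0 < ip xm r g g"
    using ip_self_nonneg[OF assms(2,3) cd] ip_self_nonneg[OF assms(2,3,5)] False by auto
  ultimately have "(ip xm r f g)\<^sup>2 \<le> ip xm r f f * ip xm r g g"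
    by (simp add: zero_le_mult_iff mult.commute)
  then have "sqrt ((ip xm r f g)\<^sup>2) \<le> sqrt (ip xm r f f * ip xm r g g)"
    by (rule real_sqrt_le_mono)
  then show ?thesis by (simp add: nrm_def real_sqrt_mult)
qed

text \<open>The elementary inequality \<open>(f - g)\<^sup>2 \<le> 2 (f - s)\<^sup>2 + 2 (g - s)\<^sup>2\<close> is all that is needed to see
  that two limits of the same partial sums coincide.\<close>

lemma continuous_L2_limit_unique:
  assumes "xm > 0" "continuous_on {0..xm} r" "\<forall>x\<in>{0..xm}. r x > 0"
    and f: "continuous_on {0..xm} f" and g: "continuous_on {0..xm} g"
    and s: "\<And>N. continuous_on {0..xm} (s N)"
    and limf: "(\<lambda>N. nrm xm r (\<lambda>x. f x - s N x)) \<longlonglongrightarrow> 0"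
    and limg: "(\<lambda>N. nrm xm r (\<lambda>x. g x - s N x)) \<longlonglongrightarrow> 0"
    and "x \<in> {0..xm}"
  shows "f x = g x"
proof -
  let ?d = "\<lambda>x. f x - g x"
  let ?bound = "\<lambda>N. 2 * (nrm xm r (\<lambda>x. f x - s N x))\<^sup>2 + 2 * (nrm xm r (\<lambda>x. g x - s N x))\<^sup>2"
  have "ip xm r ?d ?d \<le> ?bound N" for N
  proof -
    have cf: "continuous_on {0..xm} (\<lambda>x. f x - s N x)"
      and cg: "continuous_on {0..xm} (\<lambda>x. g x - s N x)"
      by (intro continuous_intros f g s)+
    let ?F = "\<lambda>x. (f x - s N x) * (f x - s N x) * r x"
    let ?G = "\<lambda>x. (g x - s N x) * (g x - s N x) * r x"
    have int: "(\<lambda>x. 2 * ?F x) integrable_on {0..xm}" "(\<lambda>x. 2 * ?G x) integrable_on {0..xm}"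
      by (intro integrable_on_mult_right ip_integrable assms cf cg)+
    have "ip xm r ?d ?d \<le> integral {0..xm} (\<lambda>x. 2 * ?F x + 2 * ?G x)"
      unfolding ip_def
    proof (rule integral_le)
      show "(\<lambda>x. (f x - g x) * (f x - g x) * r x) integrable_on {0..xm}"
        by (intro ip_integrable assms continuous_intros)
      show "(\<lambda>x. 2 * ?F x + 2 * ?G x) integrable_on {0..xm}"
        by (intro integrable_add int)
      fix x assume "x \<in> {0..xm}"
      then have "0 < r x" using assms(3) by blast
      have "0 \<le> ((f x - s N x) + (g x - s N x))\<^sup>2" by simp
      then have "(f x - g x) * (f x - g x) \<le>
          2 * ((f x - s N x) * (f x - s N x)) + 2 * ((g x - s N x) * (g x - s N x))"
        by (simp add: power2_eq_square algebra_simps)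
      from mult_right_mono[OF this less_imp_le[OF \<open>0 < r x\<close>]]
      show "(f x - g x) * (f x - g x) * r x \<le> 2 * ?F x + 2 * ?G x"
        by (simp add: algebra_simps)
    qed
    also have "\<dots> = ?bound N"
      using int by (simp add: integral_add nrm_power2[OF assms(2,3) cf] nrm_power2[OF assms(2,3) cg] ip_def)
    finally show ?thesis .
  qed
  moreover have "?bound \<longlonglongrightarrow> 2 * 0\<^sup>2 + 2 * 0\<^sup>2"
    by (intro tendsto_intros limf limg)
  ultimately have "ip xm r ?d ?d \<le> 0"
    by (intro LIMSEQ_le_const[where X = ?bound]) auto
  then have "?d x = 0"
    by (intro ip_self_zeroD[OF assms(1,2,3) _ _ assms(9)]) (auto intro!: continuous_intros f g)
  then show ?thesis by simp
qed

lemma continuous_in_L2: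
  assumes "continuous_on {0..xm} r" "continuous_on {0..xm} f"
  shows "f \<in> L2 xm r"
  unfolding L2_def
  by (auto intro!: continuous_imp_measurable_on_sets_lebesgue integrable_continuous_real
      continuous_intros assms)

lemma integral_by_parts_Icc:
  fixes f g f' g' :: "real \<Rightarrow> real"
  assumes "0 \<le> xm"
    and f: "\<And>x. x \<in> {0..xm} \<Longrightarrow> (f has_real_derivative f' x) (at x within {0..xm})"
    and g: "\<And>x. x \<in> {0..xm} \<Longrightarrow> (g has_real_derivative g' x) (at x within {0..xm})"
    and "continuous_on {0..xm} f'" "continuous_on {0..xm} g'"
  shows "integral {0..xm} (\<lambda>x. f' x * g x) =
    f xm * g xm - f 0 * g 0 - integral {0..xm} (\<lambda>x. f x * g' x)"
proof -
  have cf: "continuous_on {0..xm} f" and cg: "continuous_on {0..xm} g"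
    by (rule DERIV_continuous_on[OF f] DERIV_continuous_on[OF g]; assumption)+
  have "((\<lambda>x. f' x * g x + f x * g' x) has_integral f xm * g xm - f 0 * g 0) {0..xm}"
    using assms(1)
  proof (rule fundamental_theorem_of_calculus)
    show "((\<lambda>x. f x * g x) has_vector_derivative f' x * g x + f x * g' x) (at x within {0..xm})"
      if "x \<in> {0..xm}" for x
      using DERIV_mult'[OF f[OF that] g[OF that]]
      by (simp add: has_real_derivative_iff_has_vector_derivative add.commute)
  qed
  then have "integral {0..xm} (\<lambda>x. f' x * g x + f x * g' x) = f xm * g xm - f 0 * g 0"
    by (rule integral_unique)
  moreover have "(\<lambda>x. f' x * g x) integrable_on {0..xm}" "(\<lambda>x. f x * g' x) integrable_on {0..xm}"
    by (intro integrable_continuous_real continuous_intros assms cf cg)+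
  ultimately show ?thesis by (simp add: integral_add)
qed

lemma dx_eqI:
  assumes "(f has_real_derivative d) (at x within {0..xm})" "xm > 0" "x \<in> {0..xm}"
  shows "dx xm f x = d"
  unfolding dx_def using assms
  by (intro vector_derivative_within_closed_interval)
    (auto simp: has_real_derivative_iff_has_vector_derivative)

lemma dx_cong:
  assumes "\<And>y. y \<in> {0..xm} \<Longrightarrow> f y = g y" "x \<in> {0..xm}"
  shows "dx xm f x = dx xm g x"
proof -
  have "(f has_vector_derivative d) (at x within {0..xm})
      = (g has_vector_derivative d) (at x within {0..xm})" for d
    using assms has_vector_derivative_transform[of x "{0..xm}" f g d]
      has_vector_derivative_transform[of x "{0..xm}" g f d] by auto
  then show ?thesis by (simp add: dx_def vector_derivative_def)
qed

section \<open>Eigenfunctions\<close>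

locale weighted_interval =
  fixes xm :: real and v :: "real \<Rightarrow> real"
  assumes xm_pos: "xm > 0"
    and v_cont: "continuous_on {0..xm} v"
    and v_pos: "\<And>x. x \<in> {0..xm} \<Longrightarrow> v x > 0"
begin

lemma recip_cont: "continuous_on {0..xm} (recip v)"
  unfolding recip_def by (intro continuous_intros v_cont) (use v_pos in force)

lemma recip_pos: "\<forall>x\<in>{0..xm}. recip v x > 0"
  using v_pos by (simp add: recip_def)

lemma v_pos': "\<forall>x\<in>{0..xm}. v x > 0"
  using v_pos by blast

lemmas recip_ok = recip_cont recip_pos
lemmas v_ok = v_cont v_pos'

text \<open>The eigenvalue equation as a first order system for the eigenfunction and its flux \<open>\<psi>' / v\<close>. The
  classical domain makes both right-hand sides continuous, which every integration by parts relies on.\<close>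

lemma eigenpair_system:
  assumes "eigenpair xm v \<mu> \<psi>"
  shows eigenpair_deriv:
      "\<And>x. x \<in> {0..xm} \<Longrightarrow> (\<psi> has_real_derivative dx xm \<psi> x) (at x within {0..xm})"
    and eigenpair_flux_deriv: "\<And>x. x \<in> {0..xm} \<Longrightarrow>
      ((\<lambda>y. recip v y * dx xm \<psi> y) has_real_derivative - \<mu> * \<psi> x * recip v x) (at x within {0..xm})"
    and eigenpair_boundary: "dx xm \<psi> 0 = 0" "\<psi> xm = 0"
    and eigenpair_cont: "continuous_on {0..xm} \<psi>" "continuous_on {0..xm} (dx xm \<psi>)"
proof -
  let ?s = "\<lambda>y. 1 / v y * dx xm \<psi> y"
  have dom: "\<psi> differentiable_on {0..xm}" "?s differentiable_on {0..xm}" "dx xm \<psi> 0 = 0" "\<psi> xm = 0"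
    and eq: "\<And>x. x \<in> {0..xm} \<Longrightarrow> A_op xm v \<psi> x = \<mu> * \<psi> x"
    using assms by (auto simp: eigenpair_def dom_A_def)
  show "dx xm \<psi> 0 = 0" "\<psi> xm = 0" by fact+
  have deriv: "(f has_real_derivative dx xm f x) (at x within {0..xm})"
    if "f differentiable_on {0..xm}" "x \<in> {0..xm}" for f x
    using that unfolding dx_def has_real_derivative_iff_has_vector_derivative
    by (simp add: differentiable_on_def vector_derivative_works)
  show "(\<psi> has_real_derivative dx xm \<psi> x) (at x within {0..xm})" if "x \<in> {0..xm}" for x
    using deriv[OF dom(1) that] .
  show "continuous_on {0..xm} \<psi>"
    by (rule differentiable_imp_continuous_on[OF dom(1)])
  have "continuous_on {0..xm} (\<lambda>x. v x * ?s x)"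
    by (intro continuous_on_mult v_cont differentiable_imp_continuous_on dom(2))
  then show "continuous_on {0..xm} (dx xm \<psi>)"
    by (rule continuous_on_eq) (use v_pos in force)
  show "((\<lambda>y. recip v y * dx xm \<psi> y) has_real_derivative - \<mu> * \<psi> x * recip v x) (at x within {0..xm})"
    if "x \<in> {0..xm}" for x
  proof -
    have "- v x * dx xm ?s x = \<mu> * \<psi> x"
      using eq[OF that] by (simp add: A_op_def)
    then have "dx xm ?s x = - \<mu> * \<psi> x * recip v x"
      using v_pos[OF that] by (simp add: recip_def field_simps)
    then show ?thesis using deriv[OF dom(2) that] by (simp add: recip_def)
  qed
qed

text \<open>The energy identity \<open>\<integral> \<psi>'\<^sup>2 / v = \<mu> \<integral> \<psi>\<^sup>2 / v\<close> makes an eigenfunction with \<open>\<mu> \<le> 0\<close> constant, hence zero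
  by the Dirichlet condition at the right end. Strictness matters: \<open>sinc_fn\<close> takes the value \<open>0\<close>
  instead of its limit at the spectral parameter \<open>0\<close>.\<close>

lemma eigenvalue_pos:
  assumes "eigenpair xm v \<mu> \<psi>"
  shows "0 < \<mu>"
proof (rule ccontr)
  assume "\<not> 0 < \<mu>"
  note sys = eigenpair_system[OF assms]
  let ?s = "\<lambda>y. recip v y * dx xm \<psi> y"
  have parts: "integral {0..xm} (\<lambda>x. dx xm \<psi> x * ?s x) = - integral {0..xm} (\<lambda>x. \<psi> x * (- \<mu> * \<psi> x * recip v x))"
  proof -
    have "continuous_on {0..xm} (\<lambda>x. - \<mu> * \<psi> x * recip v x)"
      by (intro continuous_intros sys(5) recip_cont)
    from integral_by_parts_Icc[OF _ sys(1) sys(2) sys(6) this] show ?thesis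
      using xm_pos sys(3,4) by simp
  qed
  have "ip xm (recip v) (dx xm \<psi>) (dx xm \<psi>) = integral {0..xm} (\<lambda>x. dx xm \<psi> x * ?s x)"
    unfolding ip_def by (rule integral_cong) simp
  also have "\<dots> = - integral {0..xm} (\<lambda>x. (- \<mu>) * (\<psi> x * \<psi> x * recip v x))"
    unfolding parts by (simp add: algebra_simps)
  also have "\<dots> = \<mu> * ip xm (recip v) \<psi> \<psi>"
    unfolding ip_def integral_mult_right by linarith
  also have "\<dots> \<le> 0"
    using ip_self_nonneg[OF recip_ok sys(5)] \<open>\<not> 0 < \<mu>\<close> by (simp add: mult_nonpos_nonneg)
  finally have "dx xm \<psi> x = 0" if "x \<in> {0..xm}" for x
    using that by (intro ip_self_zeroD[OF xm_pos recip_ok sys(6)])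
  then have "(\<psi> has_field_derivative 0) (at x within {0..xm})" if "x \<in> {0..xm}" for x
    using sys(1)[OF that] that by simp
  then obtain c where "\<forall>x\<in>{0..xm}. \<psi> x = c"
    using has_field_derivative_zero_constant[of "{0..xm}" \<psi>] by auto
  with sys(4) xm_pos have "\<forall>x\<in>{0..xm}. \<psi> x = 0" by auto
  with assms show False by (auto simp: eigenpair_def)
qed

section \<open>Functional calculus through pairings with eigenfunctions\<close>

text \<open>Completeness of the eigenbasis makes the description of \<open>g(A) f\<close> by its pairings unambiguous:
  every candidate has, in its own eigenbasis, the same expansion as \<open>H\<close>. Asking the
  condition for all eigenpairs avoids having to compare two eigenbases.\<close>

lemma op_apply_eqI:
  assumes basis: "eigenbasis xm v \<nu> \<phi>" and H: "continuous_on {0..xm} H"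
    and pair: "\<And>\<mu> \<psi>. eigenpair xm v \<mu> \<psi> \<Longrightarrow> ip xm (recip v) H \<psi> = g \<mu> * ip xm (recip v) f \<psi>"
    and "x \<in> {0..xm}"
  shows "op_apply xm v g f x = H x"
proof -
  define K where "K = (\<lambda>x. if x \<in> {0..xm} then H x else 0)"
  have K: "continuous_on {0..xm} K"
    by (rule continuous_on_eq[OF H]) (simp add: K_def)
  have expK: "expands xm (recip v) \<eta> (\<lambda>k. g (\<kappa> k) * ip xm (recip v) f (\<eta> k)) K"
    if "eigenbasis xm v \<kappa> \<eta>" for \<kappa> \<eta>
  proof -
    have "ip xm (recip v) K (\<eta> k) = ip xm (recip v) H (\<eta> k)" for k
      by (rule ip_cong) (auto simp: K_def)
    then have "ip xm (recip v) K (\<eta> k) = g (\<kappa> k) * ip xm (recip v) f (\<eta> k)" for k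
      using that pair by (simp add: eigenbasis_def)
    moreover have "expands xm (recip v) \<eta> (\<lambda>k. ip xm (recip v) K (\<eta> k)) K"
      using that continuous_in_L2[OF recip_cont K] by (simp add: eigenbasis_def)
    ultimately show ?thesis by simp
  qed
  have "op_apply xm v g f = K"
    unfolding op_apply_def
  proof (rule the_equality)
    show "op_image xm v g (ip xm (recip v) f) K \<and> continuous_on {0..xm} K \<and>
        (\<forall>x. x \<notin> {0..xm} \<longrightarrow> K x = 0)"
      using basis expK K by (auto simp: op_image_def K_def)
  next
    fix h assume h: "op_image xm v g (ip xm (recip v) f) h \<and> continuous_on {0..xm} h \<and>
        (\<forall>x. x \<notin> {0..xm} \<longrightarrow> h x = 0)"
    then obtain \<kappa> \<eta> where basis': "eigenbasis xm v \<kappa> \<eta>"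
      and exph: "expands xm (recip v) \<eta> (\<lambda>k. g (\<kappa> k) * ip xm (recip v) f (\<eta> k)) h"
      by (auto simp: op_image_def)
    have "continuous_on {0..xm} (\<eta> k)" for k
      using basis' eigenpair_cont(1) by (auto simp: eigenbasis_def)
    then have "h x = K x" if "x \<in> {0..xm}" for x
      using expK[OF basis'] exph h K that
      by (intro continuous_L2_limit_unique[OF xm_pos recip_ok, where
            s = "\<lambda>N x. \<Sum>k<N. g (\<kappa> k) * ip xm (recip v) f (\<eta> k) * \<eta> k x"])
        (auto simp: expands_def intro!: continuous_intros)
    then show "h = K"
      using h by (intro ext) (metis K_def)
  qed
  with assms(4) show ?thesis by (simp add: K_def)
qed

lemma parseval:
  assumes basis: "eigenbasis xm v \<nu> \<phi>"
    and f: "continuous_on {0..xm} f" and h: "continuous_on {0..xm} h"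
  shows "(\<lambda>k. ip xm (recip v) f (\<phi> k) * ip xm (recip v) h (\<phi> k)) sums ip xm (recip v) f h"
proof -
  let ?c = "\<lambda>k. ip xm (recip v) f (\<phi> k)"
  let ?s = "\<lambda>N x. \<Sum>k<N. ?c k * \<phi> k x"
  have c\<phi>: "continuous_on {0..xm} (\<phi> k)" for k
    using basis eigenpair_cont(1) by (auto simp: eigenbasis_def)
  have cs: "continuous_on {0..xm} (?s N)" for N
    by (intro continuous_intros c\<phi>)
  have "expands xm (recip v) \<phi> ?c f"
    using basis continuous_in_L2[OF recip_cont f] by (simp add: eigenbasis_def)
  then have "(\<lambda>N. nrm xm (recip v) (\<lambda>x. f x - ?s N x)) \<longlonglongrightarrow> 0"
    by (simp add: expands_def)
  from tendsto_mult_left_zero[OF this]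
  have lim: "(\<lambda>N. nrm xm (recip v) (\<lambda>x. f x - ?s N x) * nrm xm (recip v) h) \<longlonglongrightarrow> 0" .
  have "ip xm (recip v) (\<lambda>x. f x - ?s N x) h =
      ip xm (recip v) f h - (\<Sum>k<N. ?c k * ip xm (recip v) h (\<phi> k))" for N
    using ip_diff_left[OF recip_cont f cs h] ip_sum_left[OF finite_lessThan recip_cont c\<phi> h]
    by (simp add: ip_commute[of xm "recip v" h])
  then have "\<bar>ip xm (recip v) f h - (\<Sum>k<N. ?c k * ip xm (recip v) h (\<phi> k))\<bar>
      \<le> nrm xm (recip v) (\<lambda>x. f x - ?s N x) * nrm xm (recip v) h" for N
    using ip_Cauchy_Schwarz[OF xm_pos recip_ok _ h, of "\<lambda>x. f x - ?s N x"]
    by (simp add: continuous_on_diff[OF f cs])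
  then have "(\<lambda>N. ip xm (recip v) f h - (\<Sum>k<N. ?c k * ip xm (recip v) h (\<phi> k))) \<longlonglongrightarrow> 0"
    by (intro Lim_null_comparison[OF _ lim]) simp
  from tendsto_diff[OF tendsto_const[of "ip xm (recip v) f h"] this]
  have "(\<lambda>N. \<Sum>k<N. ?c k * ip xm (recip v) h (\<phi> k)) \<longlonglongrightarrow> ip xm (recip v) f h"
    by simp
  then show ?thesis by (simp add: sums_def)
qed

end
section \<open>The two half-step operators\<close>

context weighted_interval
begin

text \<open>Weak forms of \<open>p = (1/v) L\<^sub>\<tau> f\<close> and of \<open>m = v L\<^sub>\<tau>\<^sup>T g\<close>: the first is tested against the derivatives
  of the eigenfunctions, the second against the eigenfunctions themselves, and all derivatives have
  been moved onto the test functions. As relations they are linear without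
  knowing that \<open>sinc(A)\<close> has a continuous value at the functions involved; a related pair
  supplies that value. The regularity of \<open>g\<close> is what allows an integration by parts back.\<close>

definition half_step_u :: "real \<Rightarrow> (real \<Rightarrow> real) \<Rightarrow> (real \<Rightarrow> real) \<Rightarrow> bool" where
  "half_step_u \<tau> f p \<longleftrightarrow> continuous_on {0..xm} f \<and> continuous_on {0..xm} p \<and>
     (\<forall>\<mu> \<psi>. eigenpair xm v \<mu> \<psi> \<longrightarrow>
        \<tau> / 2 * ip xm (\<lambda>_. 1) p (dx xm \<psi>) =
          sqrt \<mu> * sin (\<tau> / 2 * sqrt \<mu>) * ip xm (recip v) f \<psi>)"

definition half_step_w :: "real \<Rightarrow> (real \<Rightarrow> real) \<Rightarrow> (real \<Rightarrow> real) \<Rightarrow> bool" where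
  "half_step_w \<tau> g m \<longleftrightarrow> continuous_on {0..xm} m \<and> g 0 = 0 \<and>
     continuous_on {0..xm} (dx xm g) \<and>
     (\<forall>x\<in>{0..xm}. (g has_real_derivative dx xm g x) (at x within {0..xm})) \<and>
     (\<forall>\<mu> \<psi>. eigenpair xm v \<mu> \<psi> \<longrightarrow>
        \<tau> / 2 * ip xm (recip v) m \<psi> = sinc_fn \<tau> \<mu> * ip xm (\<lambda>_. 1) g (dx xm \<psi>))"

lemma half_step_w_cont: "half_step_w \<tau> g m \<Longrightarrow> continuous_on {0..xm} g"
  unfolding half_step_w_def by (meson DERIV_continuous_on)

lemma half_step_u_cong:
  assumes "half_step_u \<tau> f p" "\<And>x. x \<in> {0..xm} \<Longrightarrow> f' x = f x" "\<And>x. x \<in> {0..xm} \<Longrightarrow> p' x = p x"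
  shows "half_step_u \<tau> f' p'"
proof -
  have "ip xm (recip v) f' \<psi> = ip xm (recip v) f \<psi>"
    "ip xm (\<lambda>_. 1) p' \<psi> = ip xm (\<lambda>_. 1) p \<psi>" for \<psi>
    by (intro ip_cong; simp add: assms)+
  moreover have "continuous_on {0..xm} f'" "continuous_on {0..xm} p'"
    using assms continuous_on_cong[OF refl] unfolding half_step_u_def by metis+
  ultimately show ?thesis using assms(1) by (simp add: half_step_u_def)
qed

lemma half_step_w_cong:
  assumes "half_step_w \<tau> g m" "\<And>x. x \<in> {0..xm} \<Longrightarrow> g' x = g x" "\<And>x. x \<in> {0..xm} \<Longrightarrow> m' x = m x"
  shows "half_step_w \<tau> g' m'"
proof -
  have "ip xm (recip v) m' \<psi> = ip xm (recip v) m \<psi>"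
    "ip xm (\<lambda>_. 1) g' \<psi> = ip xm (\<lambda>_. 1) g \<psi>" for \<psi>
    by (intro ip_cong; simp add: assms)+
  moreover have dx: "dx xm g' x = dx xm g x" if "x \<in> {0..xm}" for x
    using that assms(2) by (intro dx_cong) auto
  moreover have "continuous_on {0..xm} m'"
    using assms continuous_on_cong[OF refl] unfolding half_step_w_def by metis
  moreover have "continuous_on {0..xm} (dx xm g')"
    using assms(1) dx continuous_on_eq[of "{0..xm}" "dx xm g" "dx xm g'"] unfolding half_step_w_def by simp
  moreover have "(g' has_real_derivative dx xm g' x) (at x within {0..xm})" if "x \<in> {0..xm}" for x
    using assms(1,2) that dx[OF that] has_vector_derivative_transform[of x "{0..xm}" g' g]
    unfolding half_step_w_def has_real_derivative_iff_has_vector_derivative by simp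
  moreover have "g' 0 = 0"
    using assms(1,2) xm_pos by (simp add: half_step_w_def)
  ultimately show ?thesis using assms(1) by (simp add: half_step_w_def)
qed

lemma half_step_u_lincomb:
  assumes "half_step_u \<tau> f p" "half_step_u \<tau> f' p'"
  shows "half_step_u \<tau> (\<lambda>x. a * f x + c * f' x) (\<lambda>x. a * p x + c * p' x)"
  unfolding half_step_u_def
proof (intro conjI allI impI)
  show "continuous_on {0..xm} (\<lambda>x. a * f x + c * f' x)" "continuous_on {0..xm} (\<lambda>x. a * p x + c * p' x)"
    using assms by (auto simp: half_step_u_def intro!: continuous_intros)
  fix \<mu> \<psi> assume ep: "eigenpair xm v \<mu> \<psi>"
  have "continuous_on {0..xm} f" "continuous_on {0..xm} f'"
    "continuous_on {0..xm} p" "continuous_on {0..xm} p'"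
    using assms by (simp_all add: half_step_u_def)
  note lincomb = ip_lincomb_left[OF recip_cont this(1,2) eigenpair_cont(1)[OF ep]]
    ip_lincomb_left[OF continuous_on_const this(3,4) eigenpair_cont(2)[OF ep]]
  have "\<tau> / 2 * ip xm (\<lambda>_. 1) p (dx xm \<psi>) = sqrt \<mu> * sin (\<tau> / 2 * sqrt \<mu>) * ip xm (recip v) f \<psi>"
    "\<tau> / 2 * ip xm (\<lambda>_. 1) p' (dx xm \<psi>) = sqrt \<mu> * sin (\<tau> / 2 * sqrt \<mu>) * ip xm (recip v) f' \<psi>"
    using assms ep unfolding half_step_u_def by blast+
  then show "\<tau> / 2 * ip xm (\<lambda>_. 1) (\<lambda>x. a * p x + c * p' x) (dx xm \<psi>) =
      sqrt \<mu> * sin (\<tau> / 2 * sqrt \<mu>) * ip xm (recip v) (\<lambda>x. a * f x + c * f' x) \<psi>"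
    unfolding lincomb by algebra
qed

lemma half_step_w_lincomb:
  assumes "half_step_w \<tau> g m" "half_step_w \<tau> g' m'"
  shows "half_step_w \<tau> (\<lambda>x. a * g x + c * g' x) (\<lambda>x. a * m x + c * m' x)"
proof -
  have der: "((\<lambda>x. a * g x + c * g' x) has_real_derivative a * dx xm g x + c * dx xm g' x)
      (at x within {0..xm})" if "x \<in> {0..xm}" for x
    using assms that unfolding half_step_w_def
    by (intro DERIV_add DERIV_cmult) auto
  have dx: "dx xm (\<lambda>x. a * g x + c * g' x) x = a * dx xm g x + c * dx xm g' x" if "x \<in> {0..xm}" for x
    using dx_eqI[OF der[OF that] xm_pos that] .
  show ?thesis
    unfolding half_step_w_def
  proof (intro conjI allI impI ballI)
    show "continuous_on {0..xm} (\<lambda>x. a * m x + c * m' x)"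
      using assms by (auto simp: half_step_w_def intro!: continuous_intros)
    have "continuous_on {0..xm} (\<lambda>x. a * dx xm g x + c * dx xm g' x)"
      using assms by (auto simp: half_step_w_def intro!: continuous_intros)
    then show "continuous_on {0..xm} (dx xm (\<lambda>x. a * g x + c * g' x))"
      by (rule continuous_on_eq) (simp add: dx)
    show "a * g 0 + c * g' 0 = 0"
      using assms by (simp add: half_step_w_def)
    show "((\<lambda>x. a * g x + c * g' x) has_real_derivative dx xm (\<lambda>x. a * g x + c * g' x) x)
        (at x within {0..xm})" if "x \<in> {0..xm}" for x
      using der[OF that] dx[OF that] by simp
    fix \<mu> \<psi> assume ep: "eigenpair xm v \<mu> \<psi>"
    have "continuous_on {0..xm} m" "continuous_on {0..xm} m'"
      using assms by (simp_all add: half_step_w_def)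
    note lincomb = ip_lincomb_left[OF recip_cont this eigenpair_cont(1)[OF ep]]
      ip_lincomb_left[OF continuous_on_const half_step_w_cont[OF assms(1)]
        half_step_w_cont[OF assms(2)] eigenpair_cont(2)[OF ep]]
    have "\<tau> / 2 * ip xm (recip v) m \<psi> = sinc_fn \<tau> \<mu> * ip xm (\<lambda>_. 1) g (dx xm \<psi>)"
      "\<tau> / 2 * ip xm (recip v) m' \<psi> = sinc_fn \<tau> \<mu> * ip xm (\<lambda>_. 1) g' (dx xm \<psi>)"
      using assms ep unfolding half_step_w_def by blast+
    then show "\<tau> / 2 * ip xm (recip v) (\<lambda>x. a * m x + c * m' x) \<psi> =
        sinc_fn \<tau> \<mu> * ip xm (\<lambda>_. 1) (\<lambda>x. a * g x + c * g' x) (dx xm \<psi>)"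
      unfolding lincomb by algebra
  qed
qed

lemma half_step_u_zero: "half_step_u \<tau> (\<lambda>_. 0) (\<lambda>_. 0)"
  by (simp add: half_step_u_def ip_def)

lemma half_step_w_zero: "half_step_w \<tau> (\<lambda>_. 0) (\<lambda>_. 0)"
proof -
  have "dx xm (\<lambda>_. 0) x = 0" if "x \<in> {0..xm}" for x
    by (rule dx_eqI[OF _ xm_pos that]) simp
  moreover from this have "continuous_on {0..xm} (dx xm (\<lambda>_. 0))"
    using continuous_on_eq[OF continuous_on_const[of "{0..xm}" 0], of "dx xm (\<lambda>_. 0)"] by simp
  ultimately show ?thesis by (simp add: half_step_w_def ip_def)
qed

lemma half_step_u_sum:
  assumes "finite A" "\<And>i. i \<in> A \<Longrightarrow> half_step_u \<tau> (f i) (p i)"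
  shows "half_step_u \<tau> (\<lambda>x. \<Sum>i\<in>A. c i * f i x) (\<lambda>x. \<Sum>i\<in>A. c i * p i x)"
  using assms
proof (induction A)
  case empty
  then show ?case by (simp add: half_step_u_zero)
next
  case (insert i A)
  then show ?case using half_step_u_lincomb[of \<tau> "f i" "p i" _ _ "c i" 1] by simp
qed

lemma half_step_w_sum:
  assumes "finite A" "\<And>i. i \<in> A \<Longrightarrow> half_step_w \<tau> (g i) (m i)"
  shows "half_step_w \<tau> (\<lambda>x. \<Sum>i\<in>A. c i * g i x) (\<lambda>x. \<Sum>i\<in>A. c i * m i x)"
  using assms
proof (induction A)
  case empty
  then show ?case by (simp add: half_step_w_zero)
next
  case (insert i A)
  then show ?case using half_step_w_lincomb[of \<tau> "g i" "m i" _ _ "c i" 1] by simp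
qed

text \<open>The function \<open>H\<close> below is \<open>A\<^sup>-\<^sup>1\<^sup>/\<^sup>2 sin(\<tau>\<surd>A/2) f\<close>, written as an antiderivative so that
  its derivative is known in advance; two integrations by parts against \<open>\<psi>\<close> identify its pairings.\<close>

lemma half_step_u_potential:
  assumes "half_step_u \<tau> f p"
  obtains H where "H xm = 0" "continuous_on {0..xm} H"
    "\<And>x. x \<in> {0..xm} \<Longrightarrow> (H has_real_derivative \<tau> / 2 * v x * p x) (at x within {0..xm})"
    "\<And>\<mu> \<psi>. eigenpair xm v \<mu> \<psi> \<Longrightarrow> ip xm (recip v) H \<psi> = sinc_fn \<tau> \<mu> * ip xm (recip v) f \<psi>"
proof -
  have cp: "continuous_on {0..xm} p"
    using assms by (simp add: half_step_u_def)
  then have cvp: "continuous_on {0..xm} (\<lambda>x. \<tau> / 2 * v x * p x)"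
    by (intro continuous_intros v_cont)
  then obtain H0 where H0: "\<And>x. x \<in> {0..xm} \<Longrightarrow>
      (H0 has_vector_derivative \<tau> / 2 * v x * p x) (at x within {0..xm})"
    using antiderivative_continuous by blast
  define H where "H = (\<lambda>x. H0 x - H0 xm)"
  have H: "(H has_real_derivative \<tau> / 2 * v x * p x) (at x within {0..xm})" if "x \<in> {0..xm}" for x
    unfolding H_def has_real_derivative_iff_has_vector_derivative
    using has_vector_derivative_diff[OF H0[OF that] has_vector_derivative_const] by simp
  have pair: "ip xm (recip v) H \<psi> = sinc_fn \<tau> \<mu> * ip xm (recip v) f \<psi>"
    if ep: "eigenpair xm v \<mu> \<psi>" for \<mu> \<psi>
  proof -
    note sys = eigenpair_system[OF ep]
    have "0 < \<mu>" by (rule eigenvalue_pos[OF ep])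
    have cs: "continuous_on {0..xm} (\<lambda>x. - \<mu> * \<psi> x * recip v x)"
      by (intro continuous_intros sys recip_cont)
    have "\<tau> / 2 * ip xm (\<lambda>_. 1) p (dx xm \<psi>) =
        integral {0..xm} (\<lambda>x. \<tau> / 2 * (p x * dx xm \<psi> x))"
      by (simp add: ip_def)
    also have "\<dots> = integral {0..xm} (\<lambda>x. (\<tau> / 2 * v x * p x) * (recip v x * dx xm \<psi> x))"
      by (rule integral_cong) (use v_pos in \<open>force simp: recip_def\<close>)
    also have "\<dots> = - integral {0..xm} (\<lambda>x. H x * (- \<mu> * \<psi> x * recip v x))"
      using integral_by_parts_Icc[OF _ H sys(2) cvp cs] xm_pos sys(3) by (simp add: H_def)
    also have "\<dots> = - integral {0..xm} (\<lambda>x. (- \<mu>) * (H x * \<psi> x * recip v x))"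
      by (simp add: algebra_simps)
    also have "\<dots> = \<mu> * ip xm (recip v) H \<psi>"
      unfolding ip_def integral_mult_right by linarith
    finally have "\<mu> * ip xm (recip v) H \<psi> = sqrt \<mu> * sin (\<tau> / 2 * sqrt \<mu>) * ip xm (recip v) f \<psi>"
      using assms ep by (simp add: half_step_u_def)
    moreover have "sqrt \<mu> * sin (\<tau> / 2 * sqrt \<mu>) = \<mu> * sinc_fn \<tau> \<mu>"
      using \<open>0 < \<mu>\<close> by (simp add: sinc_fn_def field_simps)
    ultimately show ?thesis using \<open>0 < \<mu>\<close> by simp
  qed
  show ?thesis
  proof (rule that[OF _ _ H pair])
    show "H xm = 0" by (simp add: H_def)
    show "continuous_on {0..xm} H" by (rule DERIV_continuous_on[OF H])
  qed
qed

lemma L_tau_half_step: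
  assumes "eigenbasis xm v \<nu> \<phi>" "half_step_u \<tau> f p" "\<tau> > 0" "x \<in> {0..xm}"
  shows "L_tau xm v \<tau> f x = v x * p x"
proof -
  obtain H where H: "continuous_on {0..xm} H"
    "\<And>x. x \<in> {0..xm} \<Longrightarrow> (H has_real_derivative \<tau> / 2 * v x * p x) (at x within {0..xm})"
    "\<And>\<mu> \<psi>. eigenpair xm v \<mu> \<psi> \<Longrightarrow> ip xm (recip v) H \<psi> = sinc_fn \<tau> \<mu> * ip xm (recip v) f \<psi>"
    using half_step_u_potential[OF assms(2)] by metis
  have "dx xm (op_apply xm v (sinc_fn \<tau>) f) x = dx xm H x"
    by (rule dx_cong[OF op_apply_eqI[OF assms(1) H(1,3)] assms(4)])
  also have "\<dots> = \<tau> / 2 * v x * p x"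
    by (rule dx_eqI[OF H(2)[OF assms(4)] xm_pos assms(4)])
  finally show ?thesis using \<open>\<tau> > 0\<close> by (simp add: L_tau_def field_simps)
qed

text \<open>The boundary terms of \<open>g \<psi>\<close> vanish by the Dirichlet conditions of \<open>g\<close> at \<open>0\<close> and of the
  eigenfunction at the right end.\<close>

lemma half_step_w_pairing:
  assumes "half_step_w \<tau> g m" "eigenpair xm v \<mu> \<psi>"
  shows "ip xm (recip v) (\<lambda>y. v y * dx xm g y) \<psi> = - ip xm (\<lambda>_. 1) g (dx xm \<psi>)"
proof -
  note sys = eigenpair_system[OF assms(2)]
  have g: "\<And>x. x \<in> {0..xm} \<Longrightarrow> (g has_real_derivative dx xm g x) (at x within {0..xm})"
    "continuous_on {0..xm} (dx xm g)" "g 0 = 0"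
    using assms(1) by (auto simp: half_step_w_def)
  have "ip xm (recip v) (\<lambda>y. v y * dx xm g y) \<psi> = integral {0..xm} (\<lambda>x. dx xm g x * \<psi> x)"
    unfolding ip_def by (rule integral_cong) (use v_pos in \<open>force simp: recip_def\<close>)
  also have "\<dots> = - integral {0..xm} (\<lambda>x. g x * dx xm \<psi> x)"
    using integral_by_parts_Icc[OF _ g(1) sys(1) g(2) sys(6)] xm_pos g(3) sys(4) by simp
  finally show ?thesis by (simp add: ip_def)
qed

lemma L_tau_T_half_step:
  assumes "eigenbasis xm v \<nu> \<phi>" "half_step_w \<tau> g m" "\<tau> > 0" "x \<in> {0..xm}"
  shows "v x * L_tau_T xm v \<tau> g x = m x"
proof -
  have "op_apply xm v (sinc_fn \<tau>) (\<lambda>y. v y * dx xm g y) x = - (\<tau> / 2) * m x"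
  proof (rule op_apply_eqI[OF assms(1) _ _ assms(4)])
    show "continuous_on {0..xm} (\<lambda>x. - (\<tau> / 2) * m x)"
      using assms(2) by (auto simp: half_step_w_def intro!: continuous_intros)
    show "ip xm (recip v) (\<lambda>x. - (\<tau> / 2) * m x) \<psi> =
        sinc_fn \<tau> \<mu> * ip xm (recip v) (\<lambda>y. v y * dx xm g y) \<psi>" if "eigenpair xm v \<mu> \<psi>" for \<mu> \<psi>
      unfolding ip_scale_left half_step_w_pairing[OF assms(2) that]
      using assms(2) that by (simp add: half_step_w_def)
  qed
  then show ?thesis
    using \<open>\<tau> > 0\<close> v_pos[OF assms(4)] by (simp add: L_tau_T_def field_simps)
qed

text \<open>The two operators are adjoint because \<open>sinc(A)\<close> is self-adjoint: on both sides the \<open>k\<close>-th term of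
  the Parseval series carries the same real factor \<open>sinc(\<mu>\<^sub>k)\<close>.\<close>

lemma half_step_adjoint:
  assumes basis: "eigenbasis xm v \<nu> \<phi>" and u: "half_step_u \<tau> f p" and w: "half_step_w \<tau> g m"
    and "\<tau> > 0"
  shows "ip xm v p g = ip xm (recip v) f m"
proof -
  obtain H where H: "H xm = 0" "continuous_on {0..xm} H"
    "\<And>x. x \<in> {0..xm} \<Longrightarrow> (H has_real_derivative \<tau> / 2 * v x * p x) (at x within {0..xm})"
    "\<And>\<mu> \<psi>. eigenpair xm v \<mu> \<psi> \<Longrightarrow> ip xm (recip v) H \<psi> = sinc_fn \<tau> \<mu> * ip xm (recip v) f \<psi>"
    using half_step_u_potential[OF u] by metis
  have g: "\<And>x. x \<in> {0..xm} \<Longrightarrow> (g has_real_derivative dx xm g x) (at x within {0..xm})"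
    "continuous_on {0..xm} (dx xm g)" "g 0 = 0" "continuous_on {0..xm} m"
    using w by (auto simp: half_step_w_def)
  have cp: "continuous_on {0..xm} p" and cf: "continuous_on {0..xm} f"
    using u by (auto simp: half_step_u_def)
  let ?k = "\<lambda>y. v y * dx xm g y"
  have ck: "continuous_on {0..xm} ?k"
    by (intro continuous_intros v_cont g)
  have cvp: "continuous_on {0..xm} (\<lambda>x. \<tau> / 2 * v x * p x)"
    by (intro continuous_intros v_cont cp)
  have "\<tau> / 2 * ip xm v p g = integral {0..xm} (\<lambda>x. (\<tau> / 2 * v x * p x) * g x)"
    unfolding ip_def integral_mult_right[symmetric] by (simp add: algebra_simps)
  also have "\<dots> = - integral {0..xm} (\<lambda>x. H x * dx xm g x)"
    using integral_by_parts_Icc[OF _ H(3) g(1) cvp g(2)] xm_pos g(3) H(1) by simp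
  also have "\<dots> = - ip xm (recip v) H ?k"
    unfolding ip_def
    by (rule arg_cong[where f = uminus], rule integral_cong) (use v_pos in \<open>force simp: recip_def\<close>)
  finally have parts: "\<tau> / 2 * ip xm v p g = - ip xm (recip v) H ?k" .
  have "ip xm (recip v) H (\<phi> k) * ip xm (recip v) ?k (\<phi> k) =
      - (\<tau> / 2) * (ip xm (recip v) f (\<phi> k) * ip xm (recip v) m (\<phi> k))" for k
  proof -
    have ep: "eigenpair xm v (\<nu> k) (\<phi> k)"
      using basis by (simp add: eigenbasis_def)
    have "\<tau> / 2 * ip xm (recip v) m (\<phi> k) = sinc_fn \<tau> (\<nu> k) * ip xm (\<lambda>_. 1) g (dx xm (\<phi> k))"
      using w ep by (simp add: half_step_w_def)
    then show ?thesis
      unfolding H(4)[OF ep] half_step_w_pairing[OF w ep] by (simp add: algebra_simps)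
  qed
  then have "(\<lambda>k. - (\<tau> / 2) * (ip xm (recip v) f (\<phi> k) * ip xm (recip v) m (\<phi> k)))
      sums ip xm (recip v) H ?k"
    using parseval[OF basis H(2) ck] by simp
  moreover have "(\<lambda>k. - (\<tau> / 2) * (ip xm (recip v) f (\<phi> k) * ip xm (recip v) m (\<phi> k)))
      sums (- (\<tau> / 2) * ip xm (recip v) f m)"
    by (intro sums_mult parseval[OF basis cf g(4)])
  ultimately have "ip xm (recip v) H ?k = - (\<tau> / 2) * ip xm (recip v) f m"
    by (rule sums_unique2)
  with parts \<open>\<tau> > 0\<close> show ?thesis by simp
qed

lemma half_step_u_unique:
  assumes "eigenbasis xm v \<nu> \<phi>" "\<tau> > 0" "half_step_u \<tau> f p" "half_step_u \<tau> f' p'"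
    "\<And>x. x \<in> {0..xm} \<Longrightarrow> f' x = f x" "x \<in> {0..xm}"
  shows "p' x = p x"
  using L_tau_half_step[OF assms(1,3,2,6)] v_pos[OF assms(6)]
    L_tau_half_step[OF assms(1) half_step_u_cong[OF assms(4), of f p'] assms(2,6)] assms(5)
  by simp

lemma half_step_w_unique:
  assumes "eigenbasis xm v \<nu> \<phi>" "\<tau> > 0" "half_step_w \<tau> g m" "half_step_w \<tau> g' m'"
    "\<And>x. x \<in> {0..xm} \<Longrightarrow> g' x = g x" "x \<in> {0..xm}"
  shows "m' x = m x"
  using L_tau_T_half_step[OF assms(1,3,2,6)]
    L_tau_T_half_step[OF assms(1) half_step_w_cong[OF assms(4), of g m'] assms(2,6)] assms(5)
  by simp

end

section \<open>The time snapshots are linked by half steps\<close>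

lemma ip_time_derivative:
  assumes F: "\<And>x t. x \<in> {0..xm} \<Longrightarrow> 0 \<le> t \<Longrightarrow>
      ((\<lambda>s. F x s) has_real_derivative Ft x t) (at t within {0..})"
    and cF: "\<And>t. 0 \<le> t \<Longrightarrow> continuous_on {0..xm} (\<lambda>x. F x t)"
    and cFt: "continuous_on ({0..xm} \<times> {0..}) (\<lambda>(x, t). Ft x t)"
    and r: "continuous_on {0..xm} r" and \<psi>: "continuous_on {0..xm} \<psi>" and "0 \<le> t"
  shows "((\<lambda>t. ip xm r (\<lambda>x. F x t) \<psi>) has_real_derivative ip xm r (\<lambda>x. Ft x t) \<psi>) (at t within {0..})"
proof -
  have "((\<lambda>t. integral (cbox 0 xm) ((\<lambda>t x. F x t * \<psi> x * r x) t)) has_real_derivative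
      integral (cbox 0 xm) ((\<lambda>t x. Ft x t * \<psi> x * r x) t)) (at t within {0..})"
  proof (rule leibniz_rule_field_derivative)
    show "((\<lambda>t. F x t * \<psi> x * r x) has_real_derivative Ft x s * \<psi> x * r x) (at s within {0..})"
      if "s \<in> {0..}" "x \<in> cbox 0 xm" for s x
      using that by (intro DERIV_cmult_right F) auto
    show "(\<lambda>x. F x s * \<psi> x * r x) integrable_on cbox 0 xm" if "s \<in> {0..}" for s
      using ip_integrable[OF r cF \<psi>, of s] that by simp
    have "continuous_on ({0..} \<times> {0..xm}) (\<lambda>z. (\<lambda>(x, t). Ft x t) (snd z, fst z))"
      by (rule continuous_on_compose2[OF cFt]) (auto intro!: continuous_intros)
    moreover have "continuous_on ({0..} \<times> {0..xm}) (\<lambda>z. \<psi> (snd z))"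
      "continuous_on ({0..} \<times> {0..xm}) (\<lambda>z. r (snd z))"
      by (rule continuous_on_compose2[OF \<psi>] continuous_on_compose2[OF r]; auto intro!: continuous_intros)+
    ultimately have "continuous_on ({0..} \<times> {0..xm}) (\<lambda>z. Ft (snd z) (fst z) * \<psi> (snd z) * r (snd z))"
      by (auto intro!: continuous_intros)
    then show "continuous_on ({0..} \<times> cbox 0 xm) (\<lambda>(t, x). Ft x t * \<psi> x * r x)"
      by (simp add: split_beta)
  qed (use \<open>0 \<le> t\<close> in auto)
  then show ?thesis by (simp add: ip_def)
qed

text \<open>Rotating the phase vector backwards by the angle \<open>s t\<close> gives two conserved quantities.\<close>

lemma oscillator_unique:
  fixes a c :: "real \<Rightarrow> real"
  assumes "0 < s"
    and a: "\<And>t. 0 \<le> t \<Longrightarrow> (a has_real_derivative - c t) (at t within {0..})"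
    and c: "\<And>t. 0 \<le> t \<Longrightarrow> (c has_real_derivative s\<^sup>2 * a t) (at t within {0..})"
    and "c 0 = 0" "0 \<le> t"
  shows "a t = a 0 * cos (s * t)" "c t = a 0 * s * sin (s * t)"
proof -
  let ?p = "\<lambda>t. a t * cos (s * t) + c t / s * sin (s * t)"
  let ?r = "\<lambda>t. a t * sin (s * t) - c t / s * cos (s * t)"
  have "(?p has_field_derivative 0) (at t within {0..})" if "t \<in> {0..}" for t
    by (rule derivative_eq_intros a c refl | use that \<open>0 < s\<close> in \<open>simp add: field_simps power2_eq_square\<close>)+
  then obtain p where p: "\<forall>t\<in>{0..}. ?p t = p"
    using has_field_derivative_zero_constant[of "{0..}" ?p] by auto
  have "(?r has_field_derivative 0) (at t within {0..})" if "t \<in> {0..}" for t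
    by (rule derivative_eq_intros a c refl | use that \<open>0 < s\<close> in \<open>simp add: field_simps power2_eq_square\<close>)+
  then obtain r where r: "\<forall>t\<in>{0..}. ?r t = r"
    using has_field_derivative_zero_constant[of "{0..}" ?r] by auto
  from p have "p = a 0" using \<open>c 0 = 0\<close> by force
  with p \<open>0 \<le> t\<close> have p_t: "?p t = a 0" by simp
  from r have "r = 0" using \<open>c 0 = 0\<close> by force
  with r \<open>0 \<le> t\<close> have r_t: "?r t = 0" by simp
  have id: "cos (s * t) * cos (s * t) + sin (s * t) * sin (s * t) = 1"
    using sin_cos_squared_add3[of "s * t"] by (simp add: add.commute)
  have "a t = a t * (cos (s * t) * cos (s * t) + sin (s * t) * sin (s * t))"
    by (simp only: id)
  also have "\<dots> = ?p t * cos (s * t) + ?r t * sin (s * t)" by algebra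
  finally show "a t = a 0 * cos (s * t)" unfolding p_t r_t by simp
  have "c t / s = c t / s * (cos (s * t) * cos (s * t) + sin (s * t) * sin (s * t))"
    by (simp only: id)
  also have "\<dots> = ?p t * sin (s * t) - ?r t * cos (s * t)" by algebra
  finally have "c t / s = a 0 * sin (s * t)" unfolding p_t r_t by simp
  with \<open>0 < s\<close> show "c t = a 0 * s * sin (s * t)" by (simp add: field_simps)
qed

context weighted_interval
begin

text \<open>Against an eigenfunction the wave system becomes a harmonic oscillator for the pairing of \<open>u\<close> with \<open>\<psi>\<close>
  and the pairing of \<open>w\<close> with \<open>\<psi>'\<close>; the boundary conditions of solution and eigenfunction cancel every
  boundary term.\<close>

lemma wave_solution_pairings:
  assumes sol: "wave_solution xm v b u w" and ep: "eigenpair xm v \<mu> \<psi>" and "0 \<le> t"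
  shows "ip xm (recip v) (\<lambda>x. u x t) \<psi> = ip xm (recip v) b \<psi> * cos (sqrt \<mu> * t)"
    "ip xm (\<lambda>_. 1) (\<lambda>x. w x t) (dx xm \<psi>) = ip xm (recip v) b \<psi> * sqrt \<mu> * sin (sqrt \<mu> * t)"
proof -
  from sol obtain ux ut wx wt where
    cont0: "\<forall>F\<in>{ux, ut, wx, wt}. continuous_on ({0..xm} \<times> {0..}) (\<lambda>(x, t). F x t)"
    and D0: "\<forall>x\<in>{0..xm}. \<forall>t\<ge>0.
        ((\<lambda>y. u y t) has_real_derivative ux x t) (at x within {0..xm}) \<and>
        ((\<lambda>s. u x s) has_real_derivative ut x t) (at t within {0..}) \<and>
        ((\<lambda>y. w y t) has_real_derivative wx x t) (at x within {0..xm}) \<and>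
        ((\<lambda>s. w x s) has_real_derivative wt x t) (at t within {0..}) \<and>
        wx x t = 1 / v x * ut x t \<and> ux x t = v x * wt x t"
    unfolding wave_solution_def by (elim conjE exE)
  have cont: "continuous_on ({0..xm} \<times> {0..}) (\<lambda>(x, t). ux x t)"
      "continuous_on ({0..xm} \<times> {0..}) (\<lambda>(x, t). ut x t)"
      "continuous_on ({0..xm} \<times> {0..}) (\<lambda>(x, t). wx x t)"
      "continuous_on ({0..xm} \<times> {0..}) (\<lambda>(x, t). wt x t)"
    using cont0 by simp_all
  note D = D0[rule_format]
  have bdry: "\<And>t. 0 \<le> t \<Longrightarrow> u xm t = 0 \<and> w 0 t = 0"
    and init: "\<And>x. x \<in> {0..xm} \<Longrightarrow> u x 0 = b x \<and> w x 0 = 0"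
    using sol unfolding wave_solution_def by (elim conjE; blast)+
  note sys = eigenpair_system[OF ep]
  have "0 < \<mu>" by (rule eigenvalue_pos[OF ep])
  have slice: "continuous_on {0..xm} (\<lambda>x. F x t)"
    if "continuous_on ({0..xm} \<times> {0..}) (\<lambda>(x, t). F x t)" "0 \<le> t" for F :: "real \<Rightarrow> real \<Rightarrow> real" and t
  proof -
    have "continuous_on {0..xm} (\<lambda>x. (\<lambda>(x, t). F x t) (x, t))"
      by (rule continuous_on_compose2[OF that(1)]) (use that(2) in \<open>auto intro!: continuous_intros\<close>)
    then show ?thesis by simp
  qed
  have ux: "\<And>x t. x \<in> {0..xm} \<Longrightarrow> 0 \<le> t \<Longrightarrow> ((\<lambda>y. u y t) has_real_derivative ux x t) (at x within {0..xm})"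
    and wx: "\<And>x t. x \<in> {0..xm} \<Longrightarrow> 0 \<le> t \<Longrightarrow> ((\<lambda>y. w y t) has_real_derivative wx x t) (at x within {0..xm})"
    and ut: "\<And>x t. x \<in> {0..xm} \<Longrightarrow> 0 \<le> t \<Longrightarrow> ((\<lambda>s. u x s) has_real_derivative ut x t) (at t within {0..})"
    and wt: "\<And>x t. x \<in> {0..xm} \<Longrightarrow> 0 \<le> t \<Longrightarrow> ((\<lambda>s. w x s) has_real_derivative wt x t) (at t within {0..})"
    by (use D in auto)+
  have cu: "continuous_on {0..xm} (\<lambda>x. u x t)" and cw: "continuous_on {0..xm} (\<lambda>x. w x t)"
    if "0 \<le> t" for t
    by (rule DERIV_continuous_on[OF ux[OF _ that]] DERIV_continuous_on[OF wx[OF _ that]]; assumption)+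
  define a where "a = (\<lambda>t. ip xm (recip v) (\<lambda>x. u x t) \<psi>)"
  define c where "c = (\<lambda>t. ip xm (\<lambda>_. 1) (\<lambda>x. w x t) (dx xm \<psi>))"
  have "(a has_real_derivative - c t) (at t within {0..})" if "0 \<le> t" for t
  proof -
    have "ip xm (recip v) (\<lambda>x. ut x t) \<psi> = integral {0..xm} (\<lambda>x. wx x t * \<psi> x)"
      unfolding ip_def by (rule integral_cong) (use D that in \<open>simp add: recip_def\<close>)
    also have "\<dots> = - integral {0..xm} (\<lambda>x. w x t * dx xm \<psi> x)"
      using integral_by_parts_Icc[OF _ wx[OF _ that] sys(1) slice[OF cont(3) that] sys(6)]
        xm_pos bdry[OF that] sys(4) by simp
    finally show ?thesis
      using ip_time_derivative[OF ut cu cont(2) recip_cont sys(5) that] by (simp add: a_def c_def ip_def)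
  qed
  moreover have "(c has_real_derivative (sqrt \<mu>)\<^sup>2 * a t) (at t within {0..})" if "0 \<le> t" for t
  proof -
    have cs: "continuous_on {0..xm} (\<lambda>x. - \<mu> * \<psi> x * recip v x)"
      by (intro continuous_intros sys recip_cont)
    have "ip xm (\<lambda>_. 1) (\<lambda>x. wt x t) (dx xm \<psi>) =
        integral {0..xm} (\<lambda>x. ux x t * (recip v x * dx xm \<psi> x))"
      unfolding ip_def
    proof (rule integral_cong)
      show "wt x t * dx xm \<psi> x * 1 = ux x t * (recip v x * dx xm \<psi> x)" if "x \<in> {0..xm}" for x
        using D[OF that \<open>0 \<le> t\<close>] v_pos[OF that] by (simp add: recip_def)
    qed
    also have "\<dots> = - integral {0..xm} (\<lambda>x. u x t * (- \<mu> * \<psi> x * recip v x))"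
      using integral_by_parts_Icc[OF _ ux[OF _ that] sys(2) slice[OF cont(1) that] cs]
        xm_pos bdry[OF that] sys(3) by simp
    also have "\<dots> = - integral {0..xm} (\<lambda>x. (- \<mu>) * (u x t * \<psi> x * recip v x))"
      by (simp add: algebra_simps)
    also have "\<dots> = (sqrt \<mu>)\<^sup>2 * a t"
      unfolding a_def ip_def integral_mult_right using \<open>0 < \<mu>\<close> by simp
    finally show ?thesis
      using ip_time_derivative[OF wt cw cont(4) continuous_on_const sys(6) that, of 1] by (simp add: c_def)
  qed
  moreover have "c 0 = ip xm (\<lambda>_. 1) (\<lambda>_. 0) (dx xm \<psi>)"
    unfolding c_def by (rule ip_cong) (simp_all add: init)
  then have "c 0 = 0" by (simp add: ip_def)
  moreover have "0 < sqrt \<mu>" using \<open>0 < \<mu>\<close> by simp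
  ultimately have osc: "a t = a 0 * cos (sqrt \<mu> * t)" "c t = a 0 * sqrt \<mu> * sin (sqrt \<mu> * t)"
    using oscillator_unique[of "sqrt \<mu>" a c t] \<open>0 \<le> t\<close> by blast+
  have "a 0 = ip xm (recip v) b \<psi>"
    unfolding a_def by (rule ip_cong) (simp_all add: init)
  with osc show "ip xm (recip v) (\<lambda>x. u x t) \<psi> = ip xm (recip v) b \<psi> * cos (sqrt \<mu> * t)"
    "ip xm (\<lambda>_. 1) (\<lambda>x. w x t) (dx xm \<psi>) = ip xm (recip v) b \<psi> * sqrt \<mu> * sin (sqrt \<mu> * t)"
    by (simp_all add: a_def c_def)
qed

lemma wave_solution_regularity:
  assumes "wave_solution xm v b u w" "0 \<le> t"
  shows "continuous_on {0..xm} (\<lambda>x. u x t)" "continuous_on {0..xm} (\<lambda>x. w x t)"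
    "continuous_on {0..xm} (dx xm (\<lambda>x. w x t))" "w 0 t = 0"
    "\<And>x. x \<in> {0..xm} \<Longrightarrow>
      ((\<lambda>x. w x t) has_real_derivative dx xm (\<lambda>x. w x t) x) (at x within {0..xm})"
proof -
  from assms(1) obtain ux ut wx wt where
    cont: "\<forall>F\<in>{ux, ut, wx, wt}. continuous_on ({0..xm} \<times> {0..}) (\<lambda>(x, t). F x t)"
    and D0: "\<forall>x\<in>{0..xm}. \<forall>t\<ge>0.
        ((\<lambda>y. u y t) has_real_derivative ux x t) (at x within {0..xm}) \<and>
        ((\<lambda>s. u x s) has_real_derivative ut x t) (at t within {0..}) \<and>
        ((\<lambda>y. w y t) has_real_derivative wx x t) (at x within {0..xm}) \<and>
        ((\<lambda>s. w x s) has_real_derivative wt x t) (at t within {0..}) \<and>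
        wx x t = 1 / v x * ut x t \<and> ux x t = v x * wt x t"
    unfolding wave_solution_def by (elim conjE exE)
  have cwx: "continuous_on ({0..xm} \<times> {0..}) (\<lambda>(x, t). wx x t)"
    using cont by simp
  have D: "\<And>x. x \<in> {0..xm} \<Longrightarrow> ((\<lambda>y. u y t) has_real_derivative ux x t) (at x within {0..xm})"
    "\<And>x. x \<in> {0..xm} \<Longrightarrow> ((\<lambda>y. w y t) has_real_derivative wx x t) (at x within {0..xm})"
    using D0 assms(2) by blast+
  show "w 0 t = 0"
    using assms unfolding wave_solution_def by blast
  show "continuous_on {0..xm} (\<lambda>x. u x t)" "continuous_on {0..xm} (\<lambda>x. w x t)"
    by (rule DERIV_continuous_on[OF D(1)] DERIV_continuous_on[OF D(2)]; assumption)+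
  have dx: "dx xm (\<lambda>x. w x t) x = wx x t" if "x \<in> {0..xm}" for x
    using dx_eqI[OF D(2)[OF that] xm_pos that] .
  then show "((\<lambda>x. w x t) has_real_derivative dx xm (\<lambda>x. w x t) x) (at x within {0..xm})"
    if "x \<in> {0..xm}" for x
    using D(2) that by simp
  have "continuous_on {0..xm} (\<lambda>x. (\<lambda>(x, t). wx x t) (x, t))"
    by (rule continuous_on_compose2[OF cwx]) (use assms(2) in \<open>auto intro!: continuous_intros\<close>)
  then show "continuous_on {0..xm} (dx xm (\<lambda>x. w x t))"
    by (rule continuous_on_eq) (simp add: dx)
qed

text \<open>The primary field is even and the dual field odd in time; the dual snapshot before the first
  one is therefore its negative.\<close>

definition w_prev :: "(real \<Rightarrow> real \<Rightarrow> real) \<Rightarrow> real \<Rightarrow> nat \<Rightarrow> real \<Rightarrow> real" where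
  "w_prev w \<tau> k = (if k = 0 then (\<lambda>x. - w_snap w \<tau> 0 x) else w_snap w \<tau> (k - 1))"

text \<open>Both relations between snapshots are addition theorems: \<open>sin(\<alpha>+\<beta>) - sin(\<alpha>-\<beta>) = 2 cos \<alpha> sin \<beta>\<close>
  and \<open>cos(\<alpha>-\<beta>) - cos(\<alpha>+\<beta>) = 2 sin \<alpha> sin \<beta>\<close>, where \<open>\<beta>\<close> is the phase of half a time step.\<close>

lemma half_step_u_snap:
  assumes sol: "wave_solution xm v b u w" and "\<tau> > 0"
  shows "half_step_u \<tau> (u_snap u \<tau> k) (\<lambda>x. 1 / \<tau> * w_snap w \<tau> k x + (- 1 / \<tau>) * w_prev w \<tau> k x)"
  unfolding half_step_u_def
proof (intro conjI allI impI)
  have nonneg: "0 \<le> real k * \<tau>" "0 \<le> (real k + 1 / 2) * \<tau>"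
    using \<open>\<tau> > 0\<close> by auto
  have cw: "continuous_on {0..xm} (w_snap w \<tau> j)" for j
    unfolding w_snap_def by (rule wave_solution_regularity(2)[OF sol]) (use \<open>\<tau> > 0\<close> in simp)
  then have cp: "continuous_on {0..xm} (w_prev w \<tau> k)"
    by (auto simp: w_prev_def intro!: continuous_intros)
  show "continuous_on {0..xm} (u_snap u \<tau> k)"
    unfolding u_snap_def by (rule wave_solution_regularity(1)[OF sol nonneg(1)])
  show "continuous_on {0..xm} (\<lambda>x. 1 / \<tau> * w_snap w \<tau> k x + (- 1 / \<tau>) * w_prev w \<tau> k x)"
    by (intro continuous_intros cw cp)
  fix \<mu> \<psi> assume ep: "eigenpair xm v \<mu> \<psi>"
  define a0 where "a0 = ip xm (recip v) b \<psi>"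
  have snap: "ip xm (\<lambda>_. 1) (w_snap w \<tau> j) (dx xm \<psi>) = a0 * sqrt \<mu> * sin (sqrt \<mu> * ((real j + 1 / 2) * \<tau>))" for j
    unfolding w_snap_def a0_def
    by (rule wave_solution_pairings(2)[OF sol ep]) (use \<open>\<tau> > 0\<close> in simp)
  have prev: "ip xm (\<lambda>_. 1) (w_prev w \<tau> k) (dx xm \<psi>) =
      a0 * sqrt \<mu> * sin (sqrt \<mu> * ((real k - 1 / 2) * \<tau>))"
  proof (cases k)
    case 0
    have "ip xm (\<lambda>_. 1) (\<lambda>x. - 1 * w_snap w \<tau> 0 x) (dx xm \<psi>) = - 1 * (a0 * sqrt \<mu> * sin (sqrt \<mu> * (1 / 2 * \<tau>)))"
      unfolding ip_scale_left snap by simp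
    then show ?thesis using 0 by (simp add: w_prev_def)
  next
    case (Suc j)
    then show ?thesis using snap[of j] by (simp add: w_prev_def algebra_simps)
  qed
  have pu: "ip xm (recip v) (u_snap u \<tau> k) \<psi> = a0 * cos (sqrt \<mu> * (real k * \<tau>))"
    unfolding u_snap_def a0_def by (rule wave_solution_pairings(1)[OF sol ep nonneg(1)])
  define A B where "A = sqrt \<mu> * (real k * \<tau>)" and "B = \<tau> / 2 * sqrt \<mu>"
  have AB: "sqrt \<mu> * ((real k + 1 / 2) * \<tau>) = A + B" "sqrt \<mu> * ((real k - 1 / 2) * \<tau>) = A - B"
    by (simp_all add: A_def B_def algebra_simps)
  have "ip xm (\<lambda>_. 1) (\<lambda>x. 1 / \<tau> * w_snap w \<tau> k x + (- 1 / \<tau>) * w_prev w \<tau> k x) (dx xm \<psi>) =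
      1 / \<tau> * (a0 * sqrt \<mu> * (sin (A + B) - sin (A - B)))"
    unfolding ip_lincomb_left[OF continuous_on_const cw cp eigenpair_cont(2)[OF ep]] snap prev AB
    by (simp add: algebra_simps)
  also have "sin (A + B) - sin (A - B) = 2 * (cos A * sin B)"
    by (simp add: sin_add sin_diff)
  finally show "\<tau> / 2 * ip xm (\<lambda>_. 1) (\<lambda>x. 1 / \<tau> * w_snap w \<tau> k x + (- 1 / \<tau>) * w_prev w \<tau> k x) (dx xm \<psi>) =
      sqrt \<mu> * sin (\<tau> / 2 * sqrt \<mu>) * ip xm (recip v) (u_snap u \<tau> k) \<psi>"
    using \<open>\<tau> > 0\<close> unfolding pu A_def[symmetric] B_def[symmetric] by simp
qed

lemma half_step_w_snap:
  assumes sol: "wave_solution xm v b u w" and "\<tau> > 0"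
  shows "half_step_w \<tau> (w_snap w \<tau> k) (\<lambda>x. 1 / \<tau> * u_snap u \<tau> k x + (- 1 / \<tau>) * u_snap u \<tau> (Suc k) x)"
  unfolding half_step_w_def
proof (intro conjI allI impI ballI)
  have nonneg: "0 \<le> (real k + 1 / 2) * \<tau>"
    using \<open>\<tau> > 0\<close> by auto
  have cu: "continuous_on {0..xm} (u_snap u \<tau> j)" for j
    unfolding u_snap_def by (rule wave_solution_regularity(1)[OF sol]) (use \<open>\<tau> > 0\<close> in simp)
  show "continuous_on {0..xm} (\<lambda>x. 1 / \<tau> * u_snap u \<tau> k x + (- 1 / \<tau>) * u_snap u \<tau> (Suc k) x)"
    by (intro continuous_intros cu)
  show "w_snap w \<tau> k 0 = 0" "continuous_on {0..xm} (dx xm (w_snap w \<tau> k))"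
    "\<And>x. x \<in> {0..xm} \<Longrightarrow>
      (w_snap w \<tau> k has_real_derivative dx xm (w_snap w \<tau> k) x) (at x within {0..xm})"
    unfolding w_snap_def using wave_solution_regularity[OF sol nonneg] by auto
  fix \<mu> \<psi> assume ep: "eigenpair xm v \<mu> \<psi>"
  have "0 < \<mu>" by (rule eigenvalue_pos[OF ep])
  define a0 where "a0 = ip xm (recip v) b \<psi>"
  have snap: "ip xm (recip v) (u_snap u \<tau> j) \<psi> = a0 * cos (sqrt \<mu> * (real j * \<tau>))" for j
    unfolding u_snap_def a0_def
    by (rule wave_solution_pairings(1)[OF sol ep]) (use \<open>\<tau> > 0\<close> in simp)
  have pw: "ip xm (\<lambda>_. 1) (w_snap w \<tau> k) (dx xm \<psi>) = a0 * sqrt \<mu> * sin (sqrt \<mu> * ((real k + 1 / 2) * \<tau>))"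
    unfolding w_snap_def a0_def by (rule wave_solution_pairings(2)[OF sol ep nonneg])
  define A B where "A = sqrt \<mu> * ((real k + 1 / 2) * \<tau>)" and "B = \<tau> / 2 * sqrt \<mu>"
  have AB: "sqrt \<mu> * (real k * \<tau>) = A - B" "sqrt \<mu> * (real (Suc k) * \<tau>) = A + B"
    by (simp_all add: A_def B_def algebra_simps)
  have "ip xm (recip v) (\<lambda>x. 1 / \<tau> * u_snap u \<tau> k x + (- 1 / \<tau>) * u_snap u \<tau> (Suc k) x) \<psi> =
      1 / \<tau> * (a0 * (cos (A - B) - cos (A + B)))"
    unfolding ip_lincomb_left[OF recip_cont cu cu eigenpair_cont(1)[OF ep]] snap AB
    by (simp add: algebra_simps)
  also have "cos (A - B) - cos (A + B) = 2 * (sin A * sin B)"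
    by (simp add: cos_add cos_diff)
  finally show "\<tau> / 2 * ip xm (recip v) (\<lambda>x. 1 / \<tau> * u_snap u \<tau> k x + (- 1 / \<tau>) * u_snap u \<tau> (Suc k) x) \<psi> =
      sinc_fn \<tau> \<mu> * ip xm (\<lambda>_. 1) (w_snap w \<tau> k) (dx xm \<psi>)"
    using \<open>\<tau> > 0\<close> \<open>0 < \<mu>\<close> unfolding pw sinc_fn_def A_def[symmetric] B_def[symmetric] by simp
qed

end

section \<open>Algebra of the coupled recursion\<close>

text \<open>In terms of the two Gram matrices \<open>G\<close>, \<open>K\<close> the recursions enter only through the single relation
  \<open>adj\<close>, which is the adjointness of the two operators after the recursions have been used to
  eliminate them. The step to a new index reads it first in its \<open>j\<close>-th column, to get the new column
  of \<open>G\<close>, and then in its new row, to get the new row of \<open>K\<close>; the diagonal cases are exactly where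
  the choice of \<open>\<gamma>h\<close> and \<open>\<gamma>\<close> as inverse squared norms is used.\<close>

lemma coupled_recursion_orthogonal:
  fixes G K :: "nat \<Rightarrow> nat \<Rightarrow> real"
  assumes symG: "\<And>i j. G i j = G j i" and symK: "\<And>i j. K i j = K j i"
    and normG: "\<And>j. j \<in> {1..n} \<Longrightarrow> \<gamma>h j * G j j = 1"
    and normK: "\<And>j. j \<in> {1..n} \<Longrightarrow> \<gamma> j * K j j = 1"
    and K0: "\<And>j. K 0 j = 0"
    and adj: "\<And>i j. i \<in> {1..n} \<Longrightarrow> j \<in> {1..n} \<Longrightarrow>
      \<gamma> j * (K i j - K (i - 1) j) = \<gamma>h i * (G i j - G i (Suc j))"
    and "1 \<le> i" "i < j" "j \<le> n"
  shows "G i j = 0 \<and> K i j = 0"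
proof -
  have nz: "\<gamma>h j \<noteq> 0" "\<gamma> j \<noteq> 0" if "j \<in> {1..n}" for j
    using normG[OF that] normK[OF that] by auto
  have "\<forall>i k. 1 \<le> i \<longrightarrow> i < k \<longrightarrow> k \<le> j \<longrightarrow> G i k = 0 \<and> K i k = 0" if "j \<le> n" for j
    using that
  proof (induction j)
    case 0
    then show ?case by simp
  next
    case (Suc j)
    then have IH: "G i k = 0" "K i k = 0" if "1 \<le> i" "i < k" "k \<le> j" for i k
      using that by auto
    have newG: "G i (Suc j) = 0" if i: "1 \<le> i" "i \<le> j" for i
    proof (cases "i = j")
      case True
      then have "K (i - 1) j = 0"
        using IH(2)[of "i - 1" j] K0 i by (cases "i - 1 = 0") auto
      with True adj[of j j] normG[of j] normK[of j] nz(1)[of j] i Suc.prems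
      show ?thesis by (simp add: right_diff_distrib)
    next
      case False
      then have "K (i - 1) j = 0" "K i j = 0" "G i j = 0"
        using IH(2)[of "i - 1" j] IH[of i j] K0 i by (cases "i - 1 = 0"; simp)+
      with adj[of i j] nz(1)[of i] i Suc.prems show ?thesis by simp
    qed
    have newK: "K (Suc j) i = 0" if i: "1 \<le> i" "i \<le> j" for i
    proof (cases "i = j")
      case True
      have "\<gamma> j * (K (Suc j) j - K j j) = - 1"
        using adj[of "Suc j" j] newG[OF i] normG[of "Suc j"] symG[of "Suc j" j] True i Suc.prems by simp
      with True normK[of j] nz(2)[of j] i Suc.prems show ?thesis by (simp add: right_diff_distrib)
    next
      case False
      then have "K j i = 0" "G (Suc j) i = 0" "G (Suc j) (Suc i) = 0"
        using IH(2)[of i j] newG[of i] newG[of "Suc i"] i symK[of j i] symG[of "Suc j"] by auto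
      with adj[of "Suc j" i] nz(2)[of i] i Suc.prems show ?thesis by simp
    qed
    show ?case
      using IH newG newK symK by (metis le_SucE less_Suc_eq_le)
  qed
  with assms(7-9) show ?thesis by blast
qed

lemma sum_by_parts_forward:
  fixes g U :: "nat \<Rightarrow> real"
  assumes "g 0 = 0"
  shows "(\<Sum>i=1..j. g i * (U i - U (Suc i)))
    = (\<Sum>i=1..Suc j. (g i - g (i - 1)) * U i) - g (Suc j) * U (Suc j)"
  using assms by (induction j) (simp_all add: algebra_simps)

lemma sum_by_parts_backward:
  fixes h W :: "nat \<Rightarrow> real"
  shows "(\<Sum>i=1..j. h i * (W i - W (i - 1)))
    = (\<Sum>i=1..j. (h i - h (Suc i)) * W i) + h (Suc j) * W j - h 1 * W 0"
  by (induction j) (simp_all add: algebra_simps)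

lemma coefficient_from_orthogonality:
  fixes z :: "nat \<Rightarrow> real \<Rightarrow> real"
  assumes r: "continuous_on {0..xm} r"
    and z_cont: "\<And>i. i \<in> {1..j} \<Longrightarrow> continuous_on {0..xm} (z i)"
    and orth: "\<And>i k. i \<in> {1..j} \<Longrightarrow> k \<in> {1..j} \<Longrightarrow> i \<noteq> k \<Longrightarrow> ip xm r (z i) (z k) = 0"
    and s: "\<And>x. x \<in> {0..xm} \<Longrightarrow> s x = (\<Sum>i=1..j. f i * z i x)"
    and i: "i \<in> {1..j}"
  shows "ip xm r s (z i) = f i * ip xm r (z i) (z i)"
proof -
  have "ip xm r s (z i) = ip xm r (\<lambda>x. \<Sum>k=1..j. f k * z k x) (z i)"
    by (rule ip_cong) (simp_all add: s)
  also have "\<dots> = (\<Sum>k=1..j. f k * ip xm r (z k) (z i))"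
    by (rule ip_sum_left) (use r z_cont i in auto)
  also have "\<dots> = (\<Sum>k\<in>{i}. f k * ip xm r (z k) (z i))"
    by (rule sum.mono_neutral_right) (use i orth in auto)
  finally show ?thesis by simp
qed

text \<open>Up to scaling, Gram-Schmidt only depends on the flag spanned by its input. Since every
  projection is invariant under scaling of the earlier output, the scale of the \<open>j\<close>-th
  output is the diagonal entry of the triangular input.\<close>

lemma gram_schmidt_triangular:
  assumes r: "continuous_on {0..xm} r" "\<forall>x\<in>{0..xm}. r x > 0"
    and z_cont: "\<And>i. i \<in> {1..n} \<Longrightarrow> continuous_on {0..xm} (z i)"
    and nz: "\<And>i. i \<in> {1..n} \<Longrightarrow> nrm xm r (z i) \<noteq> 0"
    and orth: "\<And>i k. i \<in> {1..n} \<Longrightarrow> k \<in> {1..n} \<Longrightarrow> i \<noteq> k \<Longrightarrow> ip xm r (z i) (z k) = 0"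
    and s: "\<And>j x. j \<in> {1..n} \<Longrightarrow> x \<in> {0..xm} \<Longrightarrow> s (j - 1) x = (\<Sum>i=1..j. f j i * z i x)"
    and diag: "\<And>j. j \<in> {1..n} \<Longrightarrow> f j j \<noteq> 0"
    and gs: "gram_schmidt xm r n s g"
  shows "j \<in> {1..n} \<Longrightarrow> x \<in> {0..xm} \<Longrightarrow> g j x = f j j * z j x"
proof (induction j arbitrary: x rule: less_induct)
  case (less j)
  have "ip xm r (s (j - 1)) (\<lambda>y. g i y / nrm xm r (g i)) * (1 / nrm xm r (g i)) * g i x = f j i * z i x"
    if i: "i \<in> {1..<j}" for i
  proof -
    have i_n: "i \<in> {1..n}" using i less.prems by auto
    have g: "g i y = f i i * z i y" if "y \<in> {0..xm}" for y
      using less.IH[of i y] i less.prems that by auto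
    define N where "N = nrm xm r (g i)"
    have "ip xm r (g i) (g i) = ip xm r (\<lambda>y. f i i * z i y) (\<lambda>y. f i i * z i y)"
      by (rule ip_cong) (simp_all add: g)
    also have "\<dots> = (f i i)\<^sup>2 * ip xm r (z i) (z i)"
      by (simp add: ip_scale_left ip_commute[of xm r "z i" "\<lambda>y. f i i * z i y"] power2_eq_square)
    finally have gg: "ip xm r (g i) (g i) = (f i i)\<^sup>2 * ip xm r (z i) (z i)" .
    have oo: "ip xm r (z i) (z i) > 0"
      using nrm_power2[OF r z_cont[OF i_n]] nz[OF i_n] by (metis zero_less_power2)
    then have N2: "N\<^sup>2 = (f i i)\<^sup>2 * ip xm r (z i) (z i)"
      unfolding N_def nrm_def gg by simp
    then have "N \<noteq> 0" using diag[OF i_n] oo by auto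
    have "ip xm r (s (j - 1)) (\<lambda>y. g i y / N) = ip xm r (\<lambda>y. f i i / N * z i y) (s (j - 1))"
      unfolding ip_commute[of xm r "s (j - 1)"] by (rule ip_cong) (simp_all add: g)
    also have "\<dots> = f i i / N * ip xm r (s (j - 1)) (z i)"
      by (simp only: ip_scale_left ip_commute[of xm r "z i" "s (j - 1)"])
    also have "ip xm r (s (j - 1)) (z i) = f j i * ip xm r (z i) (z i)"
      by (rule coefficient_from_orthogonality[OF r(1) _ _ s]) (use less.prems i z_cont orth in auto)
    finally have "ip xm r (s (j - 1)) (\<lambda>y. g i y / N) * (1 / N) * g i x =
        f j i * z i x * ((f i i)\<^sup>2 * ip xm r (z i) (z i) / N\<^sup>2)"
      using g[OF less.prems(2)] by (simp add: power2_eq_square)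
    also have "(f i i)\<^sup>2 * ip xm r (z i) (z i) / N\<^sup>2 = 1"
      using \<open>N \<noteq> 0\<close> by (simp flip: N2)
    finally show ?thesis by (simp add: N_def)
  qed
  then have "(\<Sum>i=1..<j. ip xm r (s (j - 1)) (\<lambda>y. g i y / nrm xm r (g i)) * (1 / nrm xm r (g i)) * g i x) =
      (\<Sum>i=1..<j. f j i * z i x)"
    by (intro sum.cong) simp_all
  moreover have "(\<Sum>i=1..j. f j i * z i x) = (\<Sum>i=1..<j. f j i * z i x) + f j j * z j x"
    using less.prems by (simp add: sum.last_plus)
  ultimately show ?case
    using gs less.prems s[OF less.prems] by (simp add: gram_schmidt_def)
qed

text \<open>Equality on the interval is built in, since the values outside carry no meaning.\<close>

inductive in_span :: "real \<Rightarrow> (nat \<Rightarrow> real \<Rightarrow> real) \<Rightarrow> (real \<Rightarrow> real) \<Rightarrow> bool" for xm s where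
  zero: "(\<And>x. x \<in> {0..xm} \<Longrightarrow> f x = 0) \<Longrightarrow> in_span xm s f"
| step: "in_span xm s f \<Longrightarrow> (\<And>x. x \<in> {0..xm} \<Longrightarrow> g x = f x + c * s k x) \<Longrightarrow> in_span xm s g"

lemma in_span_cong:
  "in_span xm s f \<Longrightarrow> (\<And>x. x \<in> {0..xm} \<Longrightarrow> g x = f x) \<Longrightarrow> in_span xm s g"
  by (rule in_span.step[where c = 0]) auto

lemma in_span_base: "in_span xm s (s k)"
  by (rule in_span.step[OF in_span.zero[of xm "\<lambda>_. 0"], where c = 1]) auto

lemma in_span_add_scaled:
  assumes "in_span xm s g" "in_span xm s f"
  shows "in_span xm s (\<lambda>x. f x + c * g x)"
  using assms(1)
proof induction
  case (zero g)
  show ?case by (rule in_span_cong[OF assms(2)]) (simp add: zero)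
next
  case (step g h d k)
  show ?case
    by (rule in_span.step[OF step.IH, where c = "c * d" and k = k]) (simp add: step.hyps algebra_simps)
qed

section \<open>The orthogonalization algorithm\<close>

locale orthogonalized_snapshots = weighted_interval +
  fixes \<tau> :: real and n :: nat and b :: "real \<Rightarrow> real" and u w :: "real \<Rightarrow> real \<Rightarrow> real"
    and ub wb :: "nat \<Rightarrow> real \<Rightarrow> real" and \<gamma>h \<gamma> :: "nat \<Rightarrow> real"
    and \<nu> :: "nat \<Rightarrow> real" and \<phi> :: "nat \<Rightarrow> real \<Rightarrow> real"
  assumes tau_pos: "\<tau> > 0"
    and basis: "eigenbasis xm v \<nu> \<phi>"
    and sol: "wave_solution xm v b u w"
    and orthogonalization: "orthogonalization xm v \<tau> n b ub wb \<gamma>h \<gamma>"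
begin

lemma algorithm:
  assumes "j \<in> {1..n}"
  shows "nrm xm (recip v) (ub j) \<noteq> 0" "\<gamma>h j = 1 / (nrm xm (recip v) (ub j))\<^sup>2"
    "nrm xm v (wb j) \<noteq> 0" "\<gamma> j = 1 / (nrm xm v (wb j))\<^sup>2"
    "\<And>x. x \<in> {0..xm} \<Longrightarrow> wb j x = wb (j - 1) x + \<gamma>h j * (1 / v x) * L_tau xm v \<tau> (ub j) x"
    "\<And>x. x \<in> {0..xm} \<Longrightarrow> ub (Suc j) x = ub j x - \<gamma> j * v x * L_tau_T xm v \<tau> (wb j) x"
  using orthogonalization assms by (simp_all add: orthogonalization_def)

lemma algorithm_start:
  assumes "x \<in> {0..xm}"
  shows "wb 0 x = 0" "ub 1 x = u_snap u \<tau> 0 x"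
proof -
  have "u x 0 = b x"
    using sol assms unfolding wave_solution_def by (elim conjE) blast
  with orthogonalization assms show "wb 0 x = 0" "ub 1 x = u_snap u \<tau> 0 x"
    by (simp_all add: orthogonalization_def u_snap_def)
qed

lemma gamma_pos:
  assumes "j \<in> {1..n}"
  shows "\<gamma>h j > 0" "\<gamma> j > 0"
  using algorithm(1-4)[OF assms] by simp_all

lemma half_step_u_on_span:
  assumes "in_span xm (u_snap u \<tau>) f"
  obtains p where "in_span xm (w_snap w \<tau>) p" "half_step_u \<tau> f p"
proof -
  have "\<exists>p. in_span xm (w_snap w \<tau>) p \<and> half_step_u \<tau> f p"
    using assms
  proof induction
    case (zero f)
    have "half_step_u \<tau> f (\<lambda>_. 0)"
      by (rule half_step_u_cong[OF half_step_u_zero]) (simp_all add: zero)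
    then show ?case using in_span.zero[of xm "\<lambda>_. 0"] by auto
  next
    case (step f g c k)
    then obtain p where p: "in_span xm (w_snap w \<tau>) p" "half_step_u \<tau> f p" by blast
    let ?q = "\<lambda>x. 1 / \<tau> * w_snap w \<tau> k x + (- 1 / \<tau>) * w_prev w \<tau> k x"
    have "half_step_u \<tau> g (\<lambda>x. 1 * p x + c * ?q x)"
      by (rule half_step_u_cong[OF half_step_u_lincomb[where a = 1 and c = c, OF p(2) half_step_u_snap[OF sol tau_pos, of k]]])
        (auto simp: step.hyps)
    moreover have "in_span xm (w_snap w \<tau>) (w_prev w \<tau> k)"
    proof (cases "k = 0")
      case True
      show ?thesis
        by (rule in_span.step[OF in_span.zero[of xm "\<lambda>_. 0"], where c = "- 1" and k = 0])
          (simp_all add: True w_prev_def)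
    qed (simp add: w_prev_def in_span_base)
    from in_span_add_scaled[OF in_span_base[of xm "w_snap w \<tau>" k]
        in_span_add_scaled[OF this p(1), of "c * (- 1 / \<tau>)"], of "c * (1 / \<tau>)"]
    have "in_span xm (w_snap w \<tau>) (\<lambda>x. 1 * p x + c * ?q x)"
      by (rule in_span_cong) (simp add: algebra_simps)
    ultimately show ?case by blast
  qed
  with that show ?thesis by blast
qed

lemma half_step_w_on_span:
  assumes "in_span xm (w_snap w \<tau>) g"
  obtains m where "in_span xm (u_snap u \<tau>) m" "half_step_w \<tau> g m"
proof -
  have "\<exists>m. in_span xm (u_snap u \<tau>) m \<and> half_step_w \<tau> g m"
    using assms
  proof induction
    case (zero g)
    have "half_step_w \<tau> g (\<lambda>_. 0)"
      by (rule half_step_w_cong[OF half_step_w_zero]) (simp_all add: zero)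
    then show ?case using in_span.zero[of xm "\<lambda>_. 0"] by auto
  next
    case (step g h c k)
    then obtain m where m: "in_span xm (u_snap u \<tau>) m" "half_step_w \<tau> g m" by blast
    let ?q = "\<lambda>x. 1 / \<tau> * u_snap u \<tau> k x + (- 1 / \<tau>) * u_snap u \<tau> (Suc k) x"
    have "half_step_w \<tau> h (\<lambda>x. 1 * m x + c * ?q x)"
      by (rule half_step_w_cong[OF half_step_w_lincomb[where a = 1 and c = c, OF m(2) half_step_w_snap[OF sol tau_pos, of k]]])
        (auto simp: step.hyps)
    moreover from in_span_add_scaled[OF in_span_base[of xm "u_snap u \<tau>" k]
        in_span_add_scaled[OF in_span_base[of xm "u_snap u \<tau>" "Suc k"] m(1), of "c * (- 1 / \<tau>)"],
        of "c * (1 / \<tau>)"]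
    have "in_span xm (u_snap u \<tau>) (\<lambda>x. 1 * m x + c * ?q x)"
      by (rule in_span_cong) (simp add: algebra_simps)
    ultimately show ?case by blast
  qed
  with that show ?thesis by blast
qed

text \<open>Membership in the spans of the snapshots is what makes the values of the two operators on the
  iterates meaningful, and it propagates along the algorithm.\<close>

lemma iterates_half_step:
  assumes "j \<in> {1..n}"
  shows "half_step_u \<tau> (ub j) (\<lambda>x. (wb j x - wb (j - 1) x) / \<gamma>h j)"
    "half_step_w \<tau> (wb j) (\<lambda>x. (ub j x - ub (Suc j) x) / \<gamma> j)"
proof -
  have u_val: "p x = (wb j x - wb (j - 1) x) / \<gamma>h j"
    if "j \<in> {1..n}" "half_step_u \<tau> (ub j) p" "x \<in> {0..xm}" for j p x
    using algorithm(5)[OF that(1,3)] L_tau_half_step[OF basis that(2) tau_pos that(3)]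
      gamma_pos(1)[OF that(1)] v_pos[OF that(3)] by (simp add: field_simps)
  have w_val: "m x = (ub j x - ub (Suc j) x) / \<gamma> j"
    if "j \<in> {1..n}" "half_step_w \<tau> (wb j) m" "x \<in> {0..xm}" for j m x
    using algorithm(6)[OF that(1,3)] L_tau_T_half_step[OF basis that(2) tau_pos that(3)]
      gamma_pos(2)[OF that(1)] by (simp add: field_simps)
  have w_span: "in_span xm (w_snap w \<tau>) (wb (Suc j))"
    if j: "Suc j \<in> {1..n}" and U: "in_span xm (u_snap u \<tau>) (ub (Suc j))"
      and W: "in_span xm (w_snap w \<tau>) (wb j)" for j
  proof -
    obtain p where p: "in_span xm (w_snap w \<tau>) p" "half_step_u \<tau> (ub (Suc j)) p"
      using half_step_u_on_span[OF U] .
    show ?thesis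
      by (rule in_span_cong[OF in_span_add_scaled[OF p(1) W, of "\<gamma>h (Suc j)"]])
        (use u_val[OF j p(2)] gamma_pos(1)[OF j] in simp)
  qed
  have span: "in_span xm (w_snap w \<tau>) (wb j) \<and> in_span xm (u_snap u \<tau>) (ub (Suc j))" if "j \<le> n" for j
    using that
  proof (induction j)
    case 0
    show ?case
      using in_span.zero[of xm "wb 0"] in_span_cong[OF in_span_base[of xm "u_snap u \<tau>" 0], of "ub 1"]
        algorithm_start by simp
  next
    case (Suc j)
    then have j: "Suc j \<in> {1..n}" and IH: "in_span xm (w_snap w \<tau>) (wb j)" "in_span xm (u_snap u \<tau>) (ub (Suc j))"
      by auto
    note W = w_span[OF j IH(2,1)]
    obtain m where m: "in_span xm (u_snap u \<tau>) m" "half_step_w \<tau> (wb (Suc j)) m"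
      using half_step_w_on_span[OF W] .
    have "in_span xm (u_snap u \<tau>) (ub (Suc (Suc j)))"
      by (rule in_span_cong[OF in_span_add_scaled[OF m(1) IH(2), of "- \<gamma> (Suc j)"]])
        (use w_val[OF j m(2)] gamma_pos(2)[OF j] in simp)
    with W show ?case by blast
  qed
  from assms obtain i where i: "j = Suc i" "i \<le> n" by (cases j) auto
  obtain p where p: "half_step_u \<tau> (ub j) p"
    using half_step_u_on_span span[of i] i by metis
  show "half_step_u \<tau> (ub j) (\<lambda>x. (wb j x - wb (j - 1) x) / \<gamma>h j)"
    by (rule half_step_u_cong[OF p]) (simp_all add: u_val[OF assms p])
  obtain m where m: "half_step_w \<tau> (wb j) m"
    using half_step_w_on_span span[of j] assms by (metis atLeastAtMost_iff)
  show "half_step_w \<tau> (wb j) (\<lambda>x. (ub j x - ub (Suc j) x) / \<gamma> j)"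
    by (rule half_step_w_cong[OF m]) (simp_all add: w_val[OF assms m])
qed

lemma iterates_cont:
  assumes "j \<in> {1..n}"
  shows "continuous_on {0..xm} (ub j)" "continuous_on {0..xm} (wb j)"
  using iterates_half_step[OF assms] half_step_w_cont by (auto simp: half_step_u_def)

lemma iterates_normalized:
  assumes "j \<in> {1..n}"
  shows "\<gamma>h j * ip xm (recip v) (ub j) (ub j) = 1" "\<gamma> j * ip xm v (wb j) (wb j) = 1"
  using algorithm(1-4)[OF assms] nrm_power2[OF recip_ok iterates_cont(1)[OF assms]]
    nrm_power2[OF v_ok iterates_cont(2)[OF assms]] by auto

lemma iterates_orthogonal:
  assumes "i \<in> {1..n}" "j \<in> {1..n}" "i \<noteq> j"
  shows "ip xm (recip v) (ub i) (ub j) = 0" "ip xm v (wb i) (wb j) = 0"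
proof -
  let ?G = "\<lambda>i j. ip xm (recip v) (ub i) (ub j)" and ?K = "\<lambda>i j. ip xm v (wb i) (wb j)"
  have K0: "?K 0 j = 0" for j
    using ip_cong[of xm "wb 0" "\<lambda>_. 0" "wb j" "wb j" v v] algorithm_start(1) by (simp add: ip_def)
  have adj: "\<gamma> j * (?K i j - ?K (i - 1) j) = \<gamma>h i * (?G i j - ?G i (Suc j))"
    if i: "i \<in> {1..n}" and j: "j \<in> {1..n}" for i j
  proof -
    have cw: "continuous_on {0..xm} (wb (i - 1))"
    proof (cases "i - 1 = 0")
      case True
      then show ?thesis
        using continuous_on_eq[OF continuous_on_const[of "{0..xm}" 0], of "wb 0"] algorithm_start(1) by simp
    next
      case False
      then have "i - 1 \<in> {1..n}" using i by auto
      then show ?thesis by (rule iterates_cont(2))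
    qed
    have cu: "continuous_on {0..xm} (ub (Suc j))"
    proof -
      have "continuous_on {0..xm} (\<lambda>x. ub j x - \<gamma> j * ((ub j x - ub (Suc j) x) / \<gamma> j))"
        using iterates_half_step(2)[OF j] iterates_cont(1)[OF j]
        by (intro continuous_on_diff continuous_on_mult_left) (simp_all add: half_step_w_def)
      then show ?thesis using gamma_pos(2)[OF j] by simp
    qed
    have "ip xm v (\<lambda>x. (wb i x - wb (i - 1) x) / \<gamma>h i) (wb j) =
        ip xm (recip v) (ub i) (\<lambda>x. (ub j x - ub (Suc j) x) / \<gamma> j)"
      by (rule half_step_adjoint[OF basis iterates_half_step(1)[OF i] iterates_half_step(2)[OF j] tau_pos])
    moreover have "ip xm v (\<lambda>x. (wb i x - wb (i - 1) x) / \<gamma>h i) (wb j) = (?K i j - ?K (i - 1) j) / \<gamma>h i"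
      using ip_lincomb_left[OF v_cont iterates_cont(2)[OF i] cw iterates_cont(2)[OF j], of "1 / \<gamma>h i" "- 1 / \<gamma>h i"]
      by (simp add: diff_divide_distrib)
    moreover have "ip xm (recip v) (ub i) (\<lambda>x. (ub j x - ub (Suc j) x) / \<gamma> j) = (?G i j - ?G i (Suc j)) / \<gamma> j"
      using ip_lincomb_left[OF recip_cont iterates_cont(1)[OF j] cu iterates_cont(1)[OF i], of "1 / \<gamma> j" "- 1 / \<gamma> j"]
      by (simp add: diff_divide_distrib ip_commute[of xm "recip v" "ub i"])
    ultimately have "(?K i j - ?K (i - 1) j) / \<gamma>h i = (?G i j - ?G i (Suc j)) / \<gamma> j"
      by simp
    then show ?thesis
      using gamma_pos(1)[OF i] gamma_pos(2)[OF j] by (simp add: field_simps)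
  qed
  have *: "?G i j = 0 \<and> ?K i j = 0" if "1 \<le> i" "i < j" "j \<le> n" for i j
    by (rule coupled_recursion_orthogonal[where n = n and \<gamma>h = \<gamma>h and \<gamma> = \<gamma> and G = ?G and K = ?K])
      (fact ip_commute iterates_normalized K0 adj that)+
  show "?G i j = 0" "?K i j = 0"
    using *[of i j] *[of j i] assms ip_commute[of xm _ "ub i"] ip_commute[of xm _ "wb i"]
    by (metis atLeastAtMost_iff linorder_neqE_nat)+
qed

text \<open>Vanishing outside \<open>1, \<dots>, j\<close> lets the updates below shift indices without boundary terms.\<close>

definition expansion_coefficients :: "nat \<Rightarrow> (nat \<Rightarrow> real) \<Rightarrow> (nat \<Rightarrow> real) \<Rightarrow> bool" where
  "expansion_coefficients j e f \<longleftrightarrow>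
    (\<forall>i. i \<notin> {1..j} \<longrightarrow> e i = 0 \<and> f i = 0) \<and> e j \<noteq> 0 \<and> f j \<noteq> 0 \<and>
    (\<forall>x\<in>{0..xm}. u_snap u \<tau> (j - 1) x = (\<Sum>i=1..j. e i * ub i x)) \<and>
    (\<forall>x\<in>{0..xm}. w_snap w \<tau> (j - 1) x = (\<Sum>i=1..j. f i * wb i x)) \<and>
    (\<Sum>i=1..j. e i) = 1 \<and>
    (\<Sum>i=1..j. f i * (\<Sum>k=1..i. \<gamma>h k)) = (2 * real j - 1) * (\<tau> / 2)"

text \<open>The leapfrog relations produce the coefficients one snapshot at a time. Passing to the next
  primary snapshot adds a combination of differences of primary iterates, so the sum of the coefficients
  keeps its initial value \<open>1\<close>. The linear functional that sends the \<open>i\<close>-th dual iterate to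
  \<open>\<gamma>h\<^sub>1 + \<dots> + \<gamma>h\<^sub>i\<close> grows by \<open>\<tau>\<close> from one dual snapshot to the next; it starts at \<open>\<tau>/2\<close>, because the
  first dual snapshot is half of a full step from its mirror image in time. Both facts express evaluation at
  the spectral parameter \<open>s = 0\<close>, where \<open>cos(k\<tau>s)\<close> is \<open>1\<close> and \<open>sin((k+1/2)\<tau>s)/s\<close> tends to \<open>(k+1/2)\<tau>\<close>.\<close>

lemma snapshot_expansion:
  assumes "j \<in> {1..n}"
  shows "\<exists>e f. expansion_coefficients j e f"
proof -
  from assms have "1 \<le> j" "j \<le> n" by auto
  then show ?thesis
  proof (induction j rule: nat_induct_at_least)
    case base
    then have one: "1 \<in> {1..n}" by simp
    have "2 / \<tau> * w_snap w \<tau> 0 x = wb 1 x / \<gamma>h 1" if "x \<in> {0..xm}" for x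
      using half_step_u_unique[OF basis tau_pos half_step_u_snap[OF sol tau_pos, of 0]
          iterates_half_step(1)[OF one] algorithm_start(2) that] algorithm_start(1)[OF that]
      by (simp add: w_prev_def)
    then have "w_snap w \<tau> 0 x = \<tau> / (2 * \<gamma>h 1) * wb 1 x" if "x \<in> {0..xm}" for x
      using that gamma_pos(1)[OF one] tau_pos by (simp add: field_simps)
    then show ?case
      unfolding expansion_coefficients_def
      using gamma_pos(1)[OF one] tau_pos algorithm_start(2)
      by (intro exI[of _ "\<lambda>i. if i = 1 then 1 else 0"] exI[of _ "\<lambda>i. if i = 1 then \<tau> / (2 * \<gamma>h 1) else 0"])
        simp
  next
    case (Suc j)
    then obtain e f where "expansion_coefficients j e f" by auto
    then have van: "\<And>i. i \<notin> {1..j} \<Longrightarrow> e i = 0 \<and> f i = 0"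
      and nz: "e j \<noteq> 0" "f j \<noteq> 0"
      and ue: "\<And>x. x \<in> {0..xm} \<Longrightarrow> u_snap u \<tau> (j - 1) x = (\<Sum>i=1..j. e i * ub i x)"
      and wf: "\<And>x. x \<in> {0..xm} \<Longrightarrow> w_snap w \<tau> (j - 1) x = (\<Sum>i=1..j. f i * wb i x)"
      and sum_e: "(\<Sum>i=1..j. e i) = 1"
      and sum_f: "(\<Sum>i=1..j. f i * (\<Sum>k=1..i. \<gamma>h k)) = (2 * real j - 1) * (\<tau> / 2)"
      unfolding expansion_coefficients_def by blast+
    \<comment> \<open>Summation by parts of the two leapfrog relations: \<open>g\<close> and \<open>h\<close> are the coefficients of the differences
      of primary and dual iterates. The dual iterate with index \<open>0\<close> is zero, so its coefficient is free.\<close>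
    define g where "g i = f i / \<gamma> i" for i
    define e' where "e' i = e i - \<tau> * (g i - g (i - 1))" for i
    define h where "h i = e' i / \<gamma>h i" for i
    define f' where "f' i = (if i = 0 then 0 else f i + \<tau> * (h i - h (Suc i)))" for i
    have g0: "g 0 = 0" "g (Suc j) = 0" using van by (simp_all add: g_def)
    have jn: "j \<in> {1..n}" "Suc j \<in> {1..n}" using Suc by auto
    have van': "e' i = 0" "h i = 0" if "i \<notin> {1..Suc j}" for i
    proof -
      have "i \<notin> {1..j}" "i - 1 \<notin> {1..j}" using that by auto
      then show "e' i = 0" using van by (simp add: e'_def g_def)
      then show "h i = 0" by (simp add: h_def)
    qed
    have vanf': "f' i = 0" if "i \<notin> {1..Suc j}" for i
    proof -
      have "i \<notin> {1..j}" "Suc i \<notin> {1..Suc j} \<or> i = 0" using that by auto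
      then show ?thesis using van van'(2)[OF that] van'(2)[of "Suc i"] by (auto simp: f'_def)
    qed
    have nz': "e' (Suc j) \<noteq> 0" "f' (Suc j) \<noteq> 0"
    proof -
      show "e' (Suc j) \<noteq> 0"
        using van[of "Suc j"] nz(2) g0 gamma_pos(2)[OF jn(1)] tau_pos by (simp add: e'_def g_def)
      then have "h (Suc j) \<noteq> 0"
        using gamma_pos(1)[OF jn(2)] by (simp add: h_def)
      moreover have "f' (Suc j) = \<tau> * h (Suc j)"
        using van[of "Suc j"] van'(2)[of "Suc (Suc j)"] by (simp add: f'_def)
      ultimately show "f' (Suc j) \<noteq> 0" using tau_pos by simp
    qed
    have split: "(\<Sum>i=1..Suc j. e' i * U i) = (\<Sum>i=1..j. e i * U i) - \<tau> * (\<Sum>i=1..j. g i * (U i - U (Suc i)))"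
      for U :: "nat \<Rightarrow> real"
    proof -
      have "(\<Sum>i=1..Suc j. e' i * U i) =
          (\<Sum>i=1..Suc j. e i * U i) - \<tau> * (\<Sum>i=1..Suc j. (g i - g (i - 1)) * U i)"
        unfolding sum_distrib_left sum_subtractf[symmetric] by (simp add: e'_def algebra_simps)
      also have "(\<Sum>i=1..Suc j. (g i - g (i - 1)) * U i) = (\<Sum>i=1..j. g i * (U i - U (Suc i)))"
        using sum_by_parts_forward[of g U j] g0 by simp
      finally show ?thesis using van[of "Suc j"] by simp
    qed
    have split': "(\<Sum>i=1..Suc j. f' i * W i) =
        (\<Sum>i=1..j. f i * W i) + \<tau> * (\<Sum>i=1..Suc j. h i * (W i - W (i - 1)))"
      if "W 0 = 0" for W :: "nat \<Rightarrow> real"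
    proof -
      have "(\<Sum>i=1..Suc j. f' i * W i) =
          (\<Sum>i=1..Suc j. f i * W i) + \<tau> * (\<Sum>i=1..Suc j. (h i - h (Suc i)) * W i)"
        unfolding sum_distrib_left sum.distrib[symmetric]
        by (rule sum.cong) (auto simp: f'_def algebra_simps)
      also have "(\<Sum>i=1..Suc j. (h i - h (Suc i)) * W i) = (\<Sum>i=1..Suc j. h i * (W i - W (i - 1)))"
        using sum_by_parts_backward[of h W "Suc j"] van'(2)[of "Suc (Suc j)"] that by simp
      finally show ?thesis using van[of "Suc j"] by simp
    qed
    have ue': "u_snap u \<tau> j x = (\<Sum>i=1..Suc j. e' i * ub i x)" if x: "x \<in> {0..xm}" for x
    proof -
      have "half_step_w \<tau> (\<lambda>x. \<Sum>i=1..j. f i * wb i x) (\<lambda>x. \<Sum>i=1..j. f i * ((ub i x - ub (Suc i) x) / \<gamma> i))"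
        by (rule half_step_w_sum) (use iterates_half_step(2) jn in auto)
      from half_step_w_unique[OF basis tau_pos this half_step_w_snap[OF sol tau_pos, of "j - 1"] wf x]
      have "u_snap u \<tau> (j - 1) x - u_snap u \<tau> j x = \<tau> * (\<Sum>i=1..j. f i * ((ub i x - ub (Suc i) x) / \<gamma> i))"
        using jn tau_pos by (simp add: field_simps)
      also have "(\<Sum>i=1..j. f i * ((ub i x - ub (Suc i) x) / \<gamma> i)) = (\<Sum>i=1..j. g i * (ub i x - ub (Suc i) x))"
        by (simp add: g_def)
      finally show ?thesis using split[of "\<lambda>i. ub i x"] ue[OF x] by simp
    qed
    have sum_e': "(\<Sum>i=1..Suc j. e' i) = 1"
      using split[of "\<lambda>_. 1"] sum_e by simp
    have wf': "w_snap w \<tau> j x = (\<Sum>i=1..Suc j. f' i * wb i x)" if x: "x \<in> {0..xm}" for x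
    proof -
      have "half_step_u \<tau> (\<lambda>x. \<Sum>i=1..Suc j. e' i * ub i x)
          (\<lambda>x. \<Sum>i=1..Suc j. e' i * ((wb i x - wb (i - 1) x) / \<gamma>h i))"
        by (rule half_step_u_sum) (use iterates_half_step(1) jn in auto)
      from half_step_u_unique[OF basis tau_pos this half_step_u_snap[OF sol tau_pos, of j] ue' x]
      have "w_snap w \<tau> j x - w_snap w \<tau> (j - 1) x =
          \<tau> * (\<Sum>i=1..Suc j. e' i * ((wb i x - wb (i - 1) x) / \<gamma>h i))"
        using jn tau_pos by (simp add: w_prev_def field_simps del: sum.cl_ivl_Suc)
      also have "(\<Sum>i=1..Suc j. e' i * ((wb i x - wb (i - 1) x) / \<gamma>h i)) =
          (\<Sum>i=1..Suc j. h i * (wb i x - wb (i - 1) x))"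
        by (simp add: h_def del: sum.cl_ivl_Suc)
      finally show ?thesis
        using split'[of "\<lambda>i. wb i x"] wf[OF x] algorithm_start(1)[OF x] by (simp del: sum.cl_ivl_Suc)
    qed
    have "(\<Sum>i=1..Suc j. h i * ((\<Sum>k=1..i. \<gamma>h k) - (\<Sum>k=1..i - 1. \<gamma>h k))) = (\<Sum>i=1..Suc j. e' i)"
    proof (rule sum.cong)
      fix i assume i: "i \<in> {1..Suc j}"
      then have "\<gamma>h i \<noteq> 0" using gamma_pos(1)[of i] jn by simp
      moreover from i have "(\<Sum>k=1..i. \<gamma>h k) = (\<Sum>k=1..i - 1. \<gamma>h k) + \<gamma>h i" by (cases i) auto
      ultimately show "h i * ((\<Sum>k=1..i. \<gamma>h k) - (\<Sum>k=1..i - 1. \<gamma>h k)) = e' i" by (simp add: h_def)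
    qed simp
    then have "(\<Sum>i=1..Suc j. f' i * (\<Sum>k=1..i. \<gamma>h k)) = (2 * real j - 1) * (\<tau> / 2) + \<tau>"
      using split'[of "\<lambda>i. \<Sum>k=1..i. \<gamma>h k"] sum_f sum_e' by (simp del: sum.cl_ivl_Suc)
    then have sum_f': "(\<Sum>i=1..Suc j. f' i * (\<Sum>k=1..i. \<gamma>h k)) = (2 * real (Suc j) - 1) * (\<tau> / 2)"
      by (simp add: algebra_simps del: sum.cl_ivl_Suc)
    have "expansion_coefficients (Suc j) e' f'"
      unfolding expansion_coefficients_def using van'(1) vanf' nz' ue' wf' sum_e' sum_f'
      by (simp del: sum.cl_ivl_Suc)
    then show ?case by blast
  qed
qed

lemma gram_schmidt_scaling:
  assumes gsu: "gram_schmidt xm (recip v) n (u_snap u \<tau>) ugs"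
    and gsw: "gram_schmidt xm v n (w_snap w \<tau>) wgs" and j: "j \<in> {1..n}"
  shows "d_u xm v (u_snap u \<tau>) ub \<gamma>h j \<noteq> 0 \<and>
      (\<forall>x\<in>{0..xm}. ugs j x = inverse (d_u xm v (u_snap u \<tau>) ub \<gamma>h j) * ub j x) \<and>
      d_w xm v \<tau> (w_snap w \<tau>) wb \<gamma>h \<gamma> j \<noteq> 0 \<and>
      (\<forall>x\<in>{0..xm}. wgs j x = inverse (d_w xm v \<tau> (w_snap w \<tau>) wb \<gamma>h \<gamma> j) * wb j x)"
proof -
  obtain e f where "\<And>j. j \<in> {1..n} \<Longrightarrow> expansion_coefficients j (e j) (f j)"
    using snapshot_expansion by metis
  then have ef: "e j j \<noteq> 0 \<and> f j j \<noteq> 0 \<and>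
    (\<forall>x\<in>{0..xm}. u_snap u \<tau> (j - 1) x = (\<Sum>i=1..j. e j i * ub i x)) \<and>
    (\<forall>x\<in>{0..xm}. w_snap w \<tau> (j - 1) x = (\<Sum>i=1..j. f j i * wb i x)) \<and>
    (\<Sum>i=1..j. e j i) = 1 \<and>
    (\<Sum>i=1..j. f j i * (\<Sum>k=1..i. \<gamma>h k)) = (2 * real j - 1) * (\<tau> / 2)"
    if "j \<in> {1..n}" for j
    using that unfolding expansion_coefficients_def by blast
  have scale_u: "ugs j x = e j j * ub j x" if "x \<in> {0..xm}" for x
  proof (rule gram_schmidt_triangular[where f = e and z = ub, OF recip_ok _ _ _ _ _ gsu j that])
    show "u_snap u \<tau> (j - 1) x = (\<Sum>i=1..j. e j i * ub i x)" if "j \<in> {1..n}" "x \<in> {0..xm}" for j x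
      using ef[OF that(1)] that(2) by blast
    show "e j j \<noteq> 0" if "j \<in> {1..n}" for j
      using ef[OF that] by blast
  qed (fact iterates_cont(1) algorithm(1) iterates_orthogonal(1))+
  have scale_w: "wgs j x = f j j * wb j x" if "x \<in> {0..xm}" for x
  proof (rule gram_schmidt_triangular[where f = f and z = wb, OF v_ok _ _ _ _ _ gsw j that])
    show "w_snap w \<tau> (j - 1) x = (\<Sum>i=1..j. f j i * wb i x)" if "j \<in> {1..n}" "x \<in> {0..xm}" for j x
      using ef[OF that(1)] that(2) by blast
    show "f j j \<noteq> 0" if "j \<in> {1..n}" for j
      using ef[OF that] by blast
  qed (fact iterates_cont(2) algorithm(3) iterates_orthogonal(2))+
  have coeff_u: "\<gamma>h i * ip xm (recip v) (u_snap u \<tau> (j - 1)) (ub i) = e j i" if "i \<in> {1..<j}" for i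
  proof -
    have "ip xm (recip v) (u_snap u \<tau> (j - 1)) (ub i) = e j i * ip xm (recip v) (ub i) (ub i)"
    proof (rule coefficient_from_orthogonality[OF recip_cont, where j = j])
      show "u_snap u \<tau> (j - 1) x = (\<Sum>i=1..j. e j i * ub i x)" if "x \<in> {0..xm}" for x
        using ef[OF j] that by blast
    qed (use iterates_cont(1) iterates_orthogonal(1) j that in simp_all)
    then show ?thesis using iterates_normalized(1)[of i] j that by simp
  qed
  have coeff_w: "\<gamma> i * ip xm v (w_snap w \<tau> (j - 1)) (wb i) = f j i" if "i \<in> {1..<j}" for i
  proof -
    have "ip xm v (w_snap w \<tau> (j - 1)) (wb i) = f j i * ip xm v (wb i) (wb i)"
    proof (rule coefficient_from_orthogonality[OF v_cont, where j = j])
      show "w_snap w \<tau> (j - 1) x = (\<Sum>i=1..j. f j i * wb i x)" if "x \<in> {0..xm}" for x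
        using ef[OF j] that by blast
    qed (use iterates_cont(2) iterates_orthogonal(2) j that in simp_all)
    then show ?thesis using iterates_normalized(2)[of i] j that by simp
  qed
  have last: "(\<Sum>i=1..j. F i) = (\<Sum>i=1..<j. F i) + F j" for F :: "nat \<Rightarrow> real"
    using j by (simp add: sum.last_plus)
  have "d_u xm v (u_snap u \<tau>) ub \<gamma>h j = 1 / (1 - (\<Sum>i=1..<j. e j i))"
    using coeff_u by (simp add: d_u_def)
  also have "1 - (\<Sum>i=1..<j. e j i) = e j j"
    using ef[OF j] last[of "e j"] by linarith
  finally have du: "d_u xm v (u_snap u \<tau>) ub \<gamma>h j = 1 / e j j" .
  let ?S = "\<lambda>i. \<Sum>k=1..i. \<gamma>h k"
  have "d_w xm v \<tau> (w_snap w \<tau>) wb \<gamma>h \<gamma> j =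
      ?S j / ((2 * real j - 1) * (\<tau> / 2) - (\<Sum>i=1..<j. f j i * ?S i))"
    using coeff_w by (simp add: d_w_def)
  also have "(2 * real j - 1) * (\<tau> / 2) - (\<Sum>i=1..<j. f j i * ?S i) = f j j * ?S j"
    using ef[OF j] last[of "\<lambda>i. f j i * ?S i"] by linarith
  also have "?S j / (f j j * ?S j) = 1 / f j j"
  proof -
    have "?S j > 0" by (rule sum_pos) (use gamma_pos(1) j in auto)
    then show ?thesis by simp
  qed
  finally have dw: "d_w xm v \<tau> (w_snap w \<tau>) wb \<gamma>h \<gamma> j = 1 / f j j" .
  show ?thesis using ef[OF j] scale_u scale_w unfolding du dw by simp
qed

end

theorem proposition5p1:
  fixes xm \<tau> :: real and n :: nat
    and v q b :: "real \<Rightarrow> real" and u w :: "real \<Rightarrow> real \<Rightarrow> real"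
    and ub wb ugs wgs :: "nat \<Rightarrow> real \<Rightarrow> real" and \<gamma>h \<gamma> :: "nat \<Rightarrow> real"
  assumes "xm > 0" and "\<tau> > 0"
    and "continuous_on {0..xm} v" and "\<forall>x\<in>{0..xm}. v x > 0"
    and "admissible_q xm v q"
    and "op_image xm v (\<lambda>\<mu>. sqrt (q_tilde q \<mu>)) (delta_pairing v) b"
    and "wave_solution xm v b u w"
    and "orthogonalization xm v \<tau> n b ub wb \<gamma>h \<gamma>"
    and "gram_schmidt xm (recip v) n (u_snap u \<tau>) ugs"
    and "gram_schmidt xm v n (w_snap w \<tau>) wgs"
  shows "\<forall>j\<in>{1..n}.
      d_u xm v (u_snap u \<tau>) ub \<gamma>h j \<noteq> 0 \<and>
      (\<forall>x\<in>{0..xm}. ugs j x = inverse (d_u xm v (u_snap u \<tau>) ub \<gamma>h j) * ub j x) \<and>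
      d_w xm v \<tau> (w_snap w \<tau>) wb \<gamma>h \<gamma> j \<noteq> 0 \<and>
      (\<forall>x\<in>{0..xm}. wgs j x = inverse (d_w xm v \<tau> (w_snap w \<tau>) wb \<gamma>h \<gamma> j) * wb j x)"
proof
  fix j assume j: "j \<in> {1..n}"
  from assms(6) obtain \<nu> \<phi> where "eigenbasis xm v \<nu> \<phi>"
    unfolding op_image_def by blast
  then interpret orthogonalized_snapshots xm v \<tau> n b u w ub wb \<gamma>h \<gamma> \<nu> \<phi>
    by unfold_locales (use assms(1-4,7,8) in auto)
  show "d_u xm v (u_snap u \<tau>) ub \<gamma>h j \<noteq> 0 \<and>
      (\<forall>x\<in>{0..xm}. ugs j x = inverse (d_u xm v (u_snap u \<tau>) ub \<gamma>h j) * ub j x) \<and>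
      d_w xm v \<tau> (w_snap w \<tau>) wb \<gamma>h \<gamma> j \<noteq> 0 \<and>
      (\<forall>x\<in>{0..xm}. wgs j x = inverse (d_w xm v \<tau> (w_snap w \<tau>) wb \<gamma>h \<gamma> j) * wb j x)"
    by (rule gram_schmidt_scaling[OF assms(9,10) j])
qed

end
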